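(* For every $r\in Q_0$ there exists a unique pair $(p,\boldsymbol u)\in Q_0\times \boldsymbol U$ satisfying $$(2p+\operatorname{div}\boldsymbol u,\,q)=(r,q)\quad\forall q\in Q_0,$$ $$(\mathbf D\boldsymbol u,\mathbf D\boldsymbol z)+(p,\operatorname{div}\boldsymbol z)=0\quad\forall \boldsymbol z\in\boldsymbol U.$$ Moreover, there exists a constant $C>0$, depending only on $\Omega$, such that for every $r\in Q_0$ the corresponding pair satisfies $$\|p\|_{L^2(\Omega)}+\|\boldsymbol u\|_{H^1(\Omega)}\le C\,\|r\|_{L^2(\Omega)}.$$
   Context: $\Omega\subset\mathbb R^2$ is a bounded, connected, convex polygonal domain. $(\cdot,\cdot)$ denotes the $L^2(\Omega)$ inner product (of scalar, vector or matrix fields; for matrix fields the pointwise product is the Frobenius product). $Q_0:=L^2_0(\Omega)=\{q\in L^2(\Omega):\int_\Omega q\,dx=0\}$ and $\boldsymbol U:=[H^1_0(\Omega)]^2$. $\mathbf D\boldsymbol v:=\frac12(\nabla\boldsymbol v+(\nabla\boldsymbol v)^T)$ is the symmetric gradient. *)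

theory Defs
  imports "HOL-Analysis.Analysis"
begin

text \<open>
  Fields on a domain \<open>\<Omega>\<close> are represented by total functions on \<open>real^2\<close>; only their values on
  \<open>\<Omega>\<close> matter, and elements of \<open>L\<^sup>2(\<Omega>)\<close> are identified when they agree almost everywhere on \<open>\<Omega>\<close>.
\<close>

definition convex_polygonal_domain :: "(real^2) set \<Rightarrow> bool" where
  "convex_polygonal_domain \<Omega> \<longleftrightarrow>
     open \<Omega> \<and> \<Omega> \<noteq> {} \<and> bounded \<Omega> \<and> connected \<Omega> \<and> convex \<Omega> \<and> polytope (closure \<Omega>)"

definition ae_eq :: "(real^2) set \<Rightarrow> (real^2 \<Rightarrow> 'a) \<Rightarrow> (real^2 \<Rightarrow> 'a) \<Rightarrow> bool" where
  "ae_eq \<Omega> f g \<longleftrightarrow> (AE x in lebesgue_on \<Omega>. f x = g x)"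

text \<open>For matrix fields (values in \<open>real^2^2\<close>) the library inner product is the Frobenius product.\<close>

definition L2 :: "(real^2) set \<Rightarrow> (real^2 \<Rightarrow> 'a::euclidean_space) set" where
  "L2 \<Omega> = {f. f \<in> borel_measurable (lebesgue_on \<Omega>) \<and>
                integrable (lebesgue_on \<Omega>) (\<lambda>x. (norm (f x))\<^sup>2)}"

definition L2_inner ::
    "(real^2) set \<Rightarrow> (real^2 \<Rightarrow> 'a::euclidean_space) \<Rightarrow> (real^2 \<Rightarrow> 'a) \<Rightarrow> real" where
  "L2_inner \<Omega> f g = (LINT x|lebesgue_on \<Omega>. f x \<bullet> g x)"

definition L2_norm :: "(real^2) set \<Rightarrow> (real^2 \<Rightarrow> 'a::euclidean_space) \<Rightarrow> real" where
  "L2_norm \<Omega> f = sqrt (L2_inner \<Omega> f f)"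

definition Q0 :: "(real^2) set \<Rightarrow> (real^2 \<Rightarrow> real) set" where
  "Q0 \<Omega> = {q \<in> L2 \<Omega>. (LINT x|lebesgue_on \<Omega>. q x) = 0}"

definition partial_deriv :: "2 \<Rightarrow> (real^2 \<Rightarrow> real) \<Rightarrow> real^2 \<Rightarrow> real" where
  "partial_deriv i f x = frechet_derivative f (at x) (axis i 1)"

primrec C_k :: "nat \<Rightarrow> (real^2 \<Rightarrow> real) \<Rightarrow> bool" where
  "C_k 0 f \<longleftrightarrow> continuous_on UNIV f"
| "C_k (Suc k) f \<longleftrightarrow> (\<forall>x. f differentiable (at x)) \<and> (\<forall>i. C_k k (partial_deriv i f))"

text \<open>\<open>C\<^sub>c\<^sup>\<infinity>(\<Omega>)\<close>, each function being extended by zero to the whole plane.\<close>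

definition test_fun :: "(real^2) set \<Rightarrow> (real^2 \<Rightarrow> real) set" where
  "test_fun \<Omega> = {\<phi>. (\<forall>k. C_k k \<phi>) \<and> compact (closure {x. \<phi> x \<noteq> 0}) \<and>
                        closure {x. \<phi> x \<noteq> 0} \<subseteq> \<Omega>}"

definition is_weak_partial ::
    "(real^2) set \<Rightarrow> 2 \<Rightarrow> (real^2 \<Rightarrow> real) \<Rightarrow> (real^2 \<Rightarrow> real) \<Rightarrow> bool" where
  "is_weak_partial \<Omega> i v g \<longleftrightarrow>
     (\<forall>\<phi>\<in>test_fun \<Omega>. L2_inner \<Omega> v (partial_deriv i \<phi>) = - L2_inner \<Omega> g \<phi>)"

definition H1 :: "(real^2) set \<Rightarrow> (real^2 \<Rightarrow> real) set" where
  "H1 \<Omega> = {v \<in> L2 \<Omega>. \<forall>i. \<exists>g\<in>L2 \<Omega>. is_weak_partial \<Omega> i v g}"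

text \<open>
  For \<open>v \<in> H1 \<Omega>\<close> with \<open>\<Omega>\<close> open, weak derivatives are unique almost everywhere on \<open>\<Omega>\<close>,
  so the choice below only selects a representative.
\<close>

definition weak_partial ::
    "(real^2) set \<Rightarrow> 2 \<Rightarrow> (real^2 \<Rightarrow> real) \<Rightarrow> real^2 \<Rightarrow> real" where
  "weak_partial \<Omega> i v = (SOME g. g \<in> L2 \<Omega> \<and> is_weak_partial \<Omega> i v g)"

definition H1_norm :: "(real^2) set \<Rightarrow> (real^2 \<Rightarrow> real) \<Rightarrow> real" where
  "H1_norm \<Omega> v = sqrt ((L2_norm \<Omega> v)\<^sup>2 + (\<Sum>i\<in>UNIV. (L2_norm \<Omega> (weak_partial \<Omega> i v))\<^sup>2))"

text \<open>The closure of \<open>C\<^sub>c\<^sup>\<infinity>(\<Omega>)\<close> in \<open>H\<^sup>1(\<Omega>)\<close>.\<close>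

definition H10 :: "(real^2) set \<Rightarrow> (real^2 \<Rightarrow> real) set" where
  "H10 \<Omega> = {v \<in> H1 \<Omega>. \<exists>\<phi> :: nat \<Rightarrow> real^2 \<Rightarrow> real. (\<forall>n. \<phi> n \<in> test_fun \<Omega>) \<and>
                (\<lambda>n. H1_norm \<Omega> (\<lambda>x. \<phi> n x - v x)) \<longlonglongrightarrow> 0}"

definition U_space :: "(real^2) set \<Rightarrow> (real^2 \<Rightarrow> real^2) set" where
  "U_space \<Omega> = {u. \<forall>i. (\<lambda>x. u x $ i) \<in> H10 \<Omega>}"

definition H1_norm_vec :: "(real^2) set \<Rightarrow> (real^2 \<Rightarrow> real^2) \<Rightarrow> real" where
  "H1_norm_vec \<Omega> u = sqrt (\<Sum>i\<in>UNIV. (H1_norm \<Omega> (\<lambda>x. u x $ i))\<^sup>2)"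

definition grad :: "(real^2) set \<Rightarrow> (real^2 \<Rightarrow> real^2) \<Rightarrow> real^2 \<Rightarrow> real^2^2" where
  "grad \<Omega> u x = (\<chi> i j. weak_partial \<Omega> j (\<lambda>y. u y $ i) x)"

definition sym_grad :: "(real^2) set \<Rightarrow> (real^2 \<Rightarrow> real^2) \<Rightarrow> real^2 \<Rightarrow> real^2^2" where
  "sym_grad \<Omega> u x = (1/2) *\<^sub>R (grad \<Omega> u x + transpose (grad \<Omega> u x))"

definition divergence :: "(real^2) set \<Rightarrow> (real^2 \<Rightarrow> real^2) \<Rightarrow> real^2 \<Rightarrow> real" where
  "divergence \<Omega> u x = (\<Sum>i\<in>UNIV. weak_partial \<Omega> i (\<lambda>y. u y $ i) x)"

definition is_solution ::
    "(real^2) set \<Rightarrow> (real^2 \<Rightarrow> real) \<Rightarrow> (real^2 \<Rightarrow> real) \<Rightarrow> (real^2 \<Rightarrow> real^2) \<Rightarrow> bool" where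
  "is_solution \<Omega> r p u \<longleftrightarrow> p \<in> Q0 \<Omega> \<and> u \<in> U_space \<Omega> \<and>
     (\<forall>q\<in>Q0 \<Omega>. L2_inner \<Omega> (\<lambda>x. 2 * p x + divergence \<Omega> u x) q = L2_inner \<Omega> r q) \<and>
     (\<forall>z\<in>U_space \<Omega>. L2_inner \<Omega> (sym_grad \<Omega> u) (sym_grad \<Omega> z)
                        + L2_inner \<Omega> p (divergence \<Omega> z) = 0)"

end

theory Submission
  imports Defs "HOL-Computational_Algebra.Polynomial"
begin

text \<open>
  The first equation says \<open>p = (r - div u) / 2\<close>. Substituting this into the second one leaves the
  bilinear form \<open>(D u, D z) - (div u, div z) / 2\<close>, which in two dimensions equals
  \<open>(\<nabla> u, \<nabla> z) / 2\<close> on \<open>H\<^sup>1\<^sub>0\<close>, because \<open>(\<partial>\<^sub>1 f, \<partial>\<^sub>2 g) = (\<partial>\<^sub>2 f, \<partial>\<^sub>1 g)\<close> there. The system thus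
  reduces to the Dirichlet problems \<open>(\<nabla> u\<^sub>i, \<nabla> w) = - (r, \<partial>\<^sub>i w)\<close>, which are solved by projecting
  \<open>- r e\<^sub>i\<close> orthogonally in \<open>L\<^sup>2\<close> onto the closure of the gradients of test functions, using the
  Poincare inequality to recover \<open>u\<^sub>i\<close> from its gradient.
\<close>

subsection \<open>Smooth functions and test functions\<close>

text \<open>Two obstacles shape the development. First, \<open>weak_partial\<close> is a choice: it
  is additive, and equal to a classical derivative, only up to null sets. Uniqueness of weak
  derivatives therefore has to be established, by way of explicit smooth bumps, and calculations in
  H^1_0 go through the choice-free relation \<open>H10_grad\<close>, which records one sequence of
  test functions approximating a function and its gradient together. The interchange of partial
  derivatives and the vanishing mean of a derivative are then checked on test functions only, where
  they follow from translation invariance of the Lebesgue measure and dominated convergence of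
  difference quotients, and they pass to L^2 limits. Second, the first equation is tested with
  mean-zero functions only. It still determines p almost everywhere, because div u has mean zero on
  H^1_0 and so the residual 2p + div u - r is itself an admissible test function.\<close>

lemma partial_deriv_eq:
  assumes "(f has_derivative f') (at x)"
  shows "partial_deriv i f x = f' (axis i 1)"
  unfolding partial_deriv_def using frechet_derivative_at[OF assms] by simp

lemma C_k_SucD: "C_k (Suc k) f \<Longrightarrow> C_k k f"
proof (induction k arbitrary: f)
  case 0
  then show ?case
    by (auto simp: continuous_on_eq_continuous_within intro!: differentiable_imp_continuous_within)
next
  case (Suc k)
  then show ?case by simp
qed

lemma C_k_const: "C_k k (\<lambda>x. c)"
proof (induction k arbitrary: c)
  case (Suc k)
  have "partial_deriv i (\<lambda>x. c) = (\<lambda>x. 0)" for i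
    by (rule ext) (simp add: partial_deriv_def)
  with Suc show ?case by simp
qed simp

lemma C_k_component: "C_k k (\<lambda>x. x $ j)"
proof (cases k)
  case (Suc m)
  have *: "((\<lambda>x::real^2. x $ j) has_derivative (\<lambda>x. x $ j)) (at x)" for x
    by (rule bounded_linear_imp_has_derivative[OF bounded_linear_vec_nth])
  have "partial_deriv i (\<lambda>x. x $ j) = (\<lambda>x. axis i 1 $ j)" for i
    by (rule ext) (simp add: partial_deriv_eq[OF *])
  with Suc * show ?thesis
    by (simp add: C_k_const differentiable_def) blast
qed (simp add: linear_continuous_on bounded_linear_vec_nth)

lemma partial_deriv_add:
  assumes "f differentiable (at x)" "g differentiable (at x)"
  shows "partial_deriv i (\<lambda>x. f x + g x) x = partial_deriv i f x + partial_deriv i g x"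
  using partial_deriv_eq[OF has_derivative_add[OF assms[unfolded frechet_derivative_works]]]
  by (simp add: partial_deriv_def)

lemma partial_deriv_mult:
  assumes "f differentiable (at x)" "g differentiable (at x)"
  shows "partial_deriv i (\<lambda>x. f x * g x) x = f x * partial_deriv i g x + partial_deriv i f x * g x"
  using partial_deriv_eq[OF has_derivative_mult[OF assms[unfolded frechet_derivative_works]]]
  by (simp add: partial_deriv_def)

lemma C_k_add: "C_k k f \<Longrightarrow> C_k k g \<Longrightarrow> C_k k (\<lambda>x. f x + g x)"
proof (induction k arbitrary: f g)
  case (Suc k)
  then have "partial_deriv i (\<lambda>x. f x + g x) = (\<lambda>x. partial_deriv i f x + partial_deriv i g x)" for i
    by (intro ext partial_deriv_add) auto
  with Suc show ?case by simp
qed (simp add: continuous_on_add)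

lemma C_k_mult: "C_k k f \<Longrightarrow> C_k k g \<Longrightarrow> C_k k (\<lambda>x. f x * g x)"
proof (induction k arbitrary: f g)
  case (Suc k)
  then have "partial_deriv i (\<lambda>x. f x * g x)
      = (\<lambda>x. f x * partial_deriv i g x + partial_deriv i f x * g x)" for i
    by (intro ext partial_deriv_mult) auto
  with Suc C_k_SucD[OF Suc.prems(1)] C_k_SucD[OF Suc.prems(2)] show ?case
    by (simp add: C_k_add)
qed (simp add: continuous_on_mult)

lemma C_k_prod:
  assumes "finite S" "\<And>s. s \<in> S \<Longrightarrow> C_k k (f s)"
  shows "C_k k (\<lambda>x. \<Prod>s\<in>S. f s x)"
  using assms by (induction S) (auto simp: C_k_const C_k_mult)

lemma partial_deriv_translate:
  assumes "f differentiable (at (x + h))"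
  shows "partial_deriv i (\<lambda>x. f (x + h)) x = partial_deriv i f (x + h)"
proof -
  have "((\<lambda>x. f (x + h)) has_derivative frechet_derivative f (at (x + h))) (at x)"
    by (rule has_derivative_compose[where f="\<lambda>x. x + h" and f'="\<lambda>x. x", simplified])
       (use assms in \<open>auto simp: frechet_derivative_works intro!: derivative_eq_intros\<close>)
  from partial_deriv_eq[OF this] show ?thesis by (simp add: partial_deriv_def)
qed

lemma C_k_translate: "C_k k f \<Longrightarrow> C_k k (\<lambda>x. f (x + h))"
proof (induction k arbitrary: f)
  case 0
  have "continuous_on UNIV (\<lambda>x::real^2. x + h)" by (intro continuous_intros)
  with 0 have "continuous_on UNIV (\<lambda>x. f (x + h))"
    by (auto intro: continuous_on_compose2[of UNIV f])
  then show ?case by simp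
next
  case (Suc k)
  have "partial_deriv i (\<lambda>x. f (x + h)) = (\<lambda>x. partial_deriv i f (x + h))" for i
    using Suc by (intro ext partial_deriv_translate) auto
  moreover have "(\<lambda>x. f (x + h)) differentiable (at x)" for x
    using Suc.prems by (intro differentiable_compose[where g="\<lambda>x. x + h" and f=f]) auto
  ultimately show ?case using Suc.prems Suc.IH[of "partial_deriv _ f"] by simp
qed

text \<open>The class of functions \<open>p (1/t) exp (-1/t)\<close>, \<open>p\<close> a polynomial, is closed under
  differentiation; this gives smoothness of \<open>exp (-1/t)\<close>.\<close>

definition flat_exp :: "real poly \<Rightarrow> real \<Rightarrow> real" where
  "flat_exp p t = (if t > 0 then poly p (1/t) * exp (- (1/t)) else 0)"

lemma poly_times_exp_tendsto_0: "((\<lambda>s. poly p s * exp (- s)) \<longlongrightarrow> (0::real)) at_top"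
proof -
  have "((\<lambda>s. \<Sum>i\<le>degree p. coeff p i * (s ^ i / exp s)) \<longlongrightarrow> (\<Sum>i\<le>degree p. coeff p i * 0)) at_top"
    by (intro tendsto_intros tendsto_power_div_exp_0)
  then show ?thesis
    by (simp add: poly_altdef sum_distrib_right exp_minus divide_inverse mult.assoc)
qed

lemma flat_exp_tendsto_0: "(flat_exp p \<longlongrightarrow> 0) (at 0)"
proof -
  have "((\<lambda>t. poly p (1/t) * exp (- (1/t))) \<longlongrightarrow> 0) (at_right 0)"
    using filterlim_compose[OF poly_times_exp_tendsto_0 filterlim_inverse_at_top_right]
    by (simp add: inverse_eq_divide)
  then have "(flat_exp p \<longlongrightarrow> 0) (at_right 0)"
    by (rule Lim_transform_eventually)
       (auto simp: flat_exp_def eventually_at_filter)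
  moreover have "(flat_exp p \<longlongrightarrow> 0) (at_left 0)"
    by (rule Lim_transform_eventually[OF tendsto_const])
       (auto simp: flat_exp_def eventually_at_filter)
  ultimately show ?thesis by (simp add: filterlim_split_at)
qed

text \<open>With s = 1/t, the chain rule for t > 0 produces s^2 (p(s) - p'(s)) exp(-s), which
  explains the polynomial on the right.\<close>

lemma flat_exp_has_derivative:
  "(flat_exp p has_real_derivative flat_exp (monom 1 2 * (p - pderiv p)) t) (at t)"
proof -
  consider "t > 0" | "t < 0" | "t = 0" by linarith
  then show ?thesis
  proof cases
    case 1
    have "((\<lambda>t. poly p (1/t)) has_real_derivative poly (pderiv p) (1/t) * (- (1/t^2))) (at t)"
      using 1 by (intro DERIV_chain2[OF poly_DERIV])
        (auto intro!: derivative_eq_intros simp: power2_eq_square)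
    moreover have "((\<lambda>t. exp (- (1/t))) has_real_derivative exp (- (1/t)) * (1/t^2)) (at t)"
      using 1 by (auto intro!: derivative_eq_intros simp: power2_eq_square)
    ultimately have "((\<lambda>t. poly p (1/t) * exp (- (1/t))) has_real_derivative
        flat_exp (monom 1 2 * (p - pderiv p)) t) (at t)"
      by (rule DERIV_cong[OF DERIV_mult])
         (use 1 in \<open>simp add: flat_exp_def poly_monom algebra_simps power_divide\<close>)
    then show ?thesis
      by (rule has_field_derivative_transform_within_open[where S="{0<..}"])
         (use 1 in \<open>auto simp: flat_exp_def\<close>)
  next
    case 2
    have "((\<lambda>t. 0) has_real_derivative flat_exp (monom 1 2 * (p - pderiv p)) t) (at t)"
      using 2 by (auto simp: flat_exp_def)
    then show ?thesis
      by (rule has_field_derivative_transform_within_open[where S="{..<0}"])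
         (use 2 in \<open>auto simp: flat_exp_def\<close>)
  next
    case 3
    \<comment> \<open>Division by h is multiplication of the polynomial by its variable 1/h, so the
      difference quotient at 0 is again in the class and tends to 0.\<close>
    have "(flat_exp (monom 1 1 * p) \<longlongrightarrow> 0) (at 0)" by (rule flat_exp_tendsto_0)
    moreover have "flat_exp (monom 1 1 * p) = (\<lambda>h. (flat_exp p (0 + h) - flat_exp p 0) / h)"
      by (rule ext) (simp add: flat_exp_def poly_monom)
    ultimately have "(flat_exp p has_real_derivative 0) (at 0)"
      unfolding DERIV_def by (simp only:)
    with 3 show ?thesis by (simp add: flat_exp_def)
  qed
qed

text \<open>The polynomial is arbitrary because every differentiation replaces it. Affine functions
  of one coordinate are the arguments that occur in \<open>box_bump\<close>.\<close>

lemma C_k_flat_exp: "C_k k (\<lambda>x. flat_exp p (a * x $ j + b))"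
proof (induction k arbitrary: p)
  case 0
  have "continuous_on UNIV (flat_exp p)"
    by (rule DERIV_continuous_on[OF has_field_derivative_at_within[OF flat_exp_has_derivative]])
  moreover have "continuous_on UNIV (\<lambda>x::real^2. a * x $ j + b)"
    by (intro continuous_intros)
  ultimately have "continuous_on UNIV (\<lambda>x. flat_exp p (a * x $ j + b))"
    by (auto intro: continuous_on_compose2[of UNIV "flat_exp p"])
  then show ?case by simp
next
  case (Suc k)
  let ?q = "monom 1 2 * (p - pderiv p)"
  have *: "((\<lambda>x::real^2. flat_exp p (a * x $ j + b)) has_derivative
      (\<lambda>h. a * h $ j * flat_exp ?q (a * x $ j + b))) (at x)" for x
  proof -
    have 1: "(flat_exp p has_derivative (\<lambda>h. h * flat_exp ?q (a * x $ j + b))) (at (a * x $ j + b))"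
      using flat_exp_has_derivative[of p "a * x $ j + b"]
      by (simp add: has_field_derivative_def mult_commute_abs)
    have 2: "((\<lambda>x::real^2. a * x $ j + b) has_derivative (\<lambda>h. a * h $ j)) (at x)"
      by (auto intro!: derivative_eq_intros bounded_linear_imp_has_derivative
           bounded_linear_vec_nth)
    show ?thesis using has_derivative_compose[OF 2 1] .
  qed
  have "partial_deriv i (\<lambda>x. flat_exp p (a * x $ j + b)) =
      (\<lambda>x. (a * axis i 1 $ j) * flat_exp ?q (a * x $ j + b))" for i
    by (rule ext) (simp add: partial_deriv_eq[OF *])
  with Suc.IH[of ?q] show ?case
    using * by (auto simp: differentiable_def intro!: C_k_mult C_k_const)
qed

section \<open>Supports and closure properties of test functions\<close>

lemma test_funD:
  assumes "\<phi> \<in> test_fun \<Omega>"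
  shows "C_k k \<phi>" "\<phi> differentiable (at x)" "continuous_on UNIV \<phi>"
    "compact (closure {x. \<phi> x \<noteq> 0})" "closure {x. \<phi> x \<noteq> 0} \<subseteq> \<Omega>" "x \<notin> \<Omega> \<Longrightarrow> \<phi> x = 0"
proof -
  have *: "C_k k \<phi>" for k using assms by (auto simp: test_fun_def)
  show "C_k k \<phi>" by (rule *)
  show "\<phi> differentiable (at x)" using *[of "Suc 0"] by simp
  show "continuous_on UNIV \<phi>" using *[of 0] by simp
  show "compact (closure {x. \<phi> x \<noteq> 0})" and 1: "closure {x. \<phi> x \<noteq> 0} \<subseteq> \<Omega>"
    using assms by (auto simp: test_fun_def)
  show "x \<notin> \<Omega> \<Longrightarrow> \<phi> x = 0" using closure_subset[of "{x. \<phi> x \<noteq> 0}"] 1 by blast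
qed

lemma test_funI:
  assumes "\<And>k. C_k k \<phi>" "{x. \<phi> x \<noteq> 0} \<subseteq> K" "compact K" "K \<subseteq> \<Omega>"
  shows "\<phi> \<in> test_fun \<Omega>"
proof -
  have "closure {x. \<phi> x \<noteq> 0} \<subseteq> K"
    using assms by (intro closure_minimal compact_imp_closed)
  with assms show ?thesis
    by (auto simp: test_fun_def compact_eq_bounded_closed intro: bounded_subset)
qed

lemma test_fun_subI:
  assumes "\<phi> \<in> test_fun \<Omega>" "\<And>k. C_k k \<psi>" "\<And>x. \<phi> x = 0 \<Longrightarrow> \<psi> x = 0"
  shows "\<psi> \<in> test_fun \<Omega>"
  using assms test_funD(4,5)[OF assms(1)] closure_subset[of "{x. \<phi> x \<noteq> 0}"]
  by (intro test_funI[where K="closure {x. \<phi> x \<noteq> 0}"]) auto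

lemma test_fun_mono: "\<Omega> \<subseteq> \<Omega>' \<Longrightarrow> test_fun \<Omega> \<subseteq> test_fun \<Omega>'"
  by (auto simp: test_fun_def)

lemma test_fun_mult_left:
  "\<lbrakk>\<And>k. C_k k f; \<phi> \<in> test_fun \<Omega>\<rbrakk> \<Longrightarrow> (\<lambda>x. f x * \<phi> x) \<in> test_fun \<Omega>"
  by (rule test_fun_subI[of \<phi>]) (auto intro: C_k_mult test_funD)

lemma test_fun_zero: "(\<lambda>x. 0) \<in> test_fun \<Omega>"
  by (rule test_funI[where K="{}"]) (auto simp: C_k_const)

lemma test_fun_add:
  assumes "\<phi> \<in> test_fun \<Omega>" "\<psi> \<in> test_fun \<Omega>"
  shows "(\<lambda>x. \<phi> x + \<psi> x) \<in> test_fun \<Omega>"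
proof (rule test_funI)
  show "C_k k (\<lambda>x. \<phi> x + \<psi> x)" for k
    by (rule C_k_add[OF test_funD(1)[OF assms(1)] test_funD(1)[OF assms(2)]])
  show "{x. \<phi> x + \<psi> x \<noteq> 0} \<subseteq> closure {x. \<phi> x \<noteq> 0} \<union> closure {x. \<psi> x \<noteq> 0}"
    using closure_subset[of "{x. \<phi> x \<noteq> 0}"] closure_subset[of "{x. \<psi> x \<noteq> 0}"] by fastforce
qed (use test_funD(4,5)[OF assms(1)] test_funD(4,5)[OF assms(2)] in auto)

lemma test_fun_cmult: "\<phi> \<in> test_fun \<Omega> \<Longrightarrow> (\<lambda>x. c * \<phi> x) \<in> test_fun \<Omega>"
  by (rule test_fun_mult_left) (rule C_k_const)

lemma test_fun_translate:
  assumes "\<phi> \<in> test_fun UNIV"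
  shows "(\<lambda>x. \<phi> (x + h)) \<in> test_fun UNIV"
proof (rule test_funI)
  show "C_k k (\<lambda>x. \<phi> (x + h))" for k by (intro C_k_translate test_funD[OF assms])
  show "{x. \<phi> (x + h) \<noteq> 0} \<subseteq> (\<lambda>x. x - h) ` closure {x. \<phi> x \<noteq> 0}"
  proof clarify
    fix x assume "\<phi> (x + h) \<noteq> 0"
    then have "x + h \<in> closure {x. \<phi> x \<noteq> 0}"
      using closure_subset[of "{x. \<phi> x \<noteq> 0}"] by blast
    from imageI[OF this, of "\<lambda>x. x - h"] show "x \<in> (\<lambda>x. x - h) ` closure {x. \<phi> x \<noteq> 0}"
      by simp
  qed
  show "compact ((\<lambda>x. x - h) ` closure {x. \<phi> x \<noteq> 0})"
    by (intro compact_continuous_image continuous_intros test_funD[OF assms])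
qed simp

lemma test_fun_partial_deriv:
  assumes "\<phi> \<in> test_fun \<Omega>"
  shows "partial_deriv i \<phi> \<in> test_fun \<Omega>"
proof (rule test_funI)
  show "C_k k (partial_deriv i \<phi>)" for k using test_funD(1)[OF assms, of "Suc k"] by simp
  show "{x. partial_deriv i \<phi> x \<noteq> 0} \<subseteq> closure {x. \<phi> x \<noteq> 0}"
  proof clarify
    fix x assume nz: "partial_deriv i \<phi> x \<noteq> 0"
    show "x \<in> closure {x. \<phi> x \<noteq> 0}"
    proof (rule ccontr)
      assume "x \<notin> closure {x. \<phi> x \<noteq> 0}"
      \<comment> \<open>The complement of the closed support is open, so \<phi> agrees with zero
        near x.\<close>
      then have "(\<phi> has_derivative (\<lambda>x. 0)) (at x)"
        using closure_subset[of "{x. \<phi> x \<noteq> 0}"]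
        by - (rule has_derivative_transform_within_open[where f="\<lambda>x. 0"
              and s="- closure {x. \<phi> x \<noteq> 0}"], auto simp: subset_eq)
      from partial_deriv_eq[OF this] nz show False by simp
    qed
  qed
qed (use test_funD(4,5)[OF assms] in auto)

lemma test_fun_bounded:
  assumes "\<phi> \<in> test_fun \<Omega>"
  obtains B where "\<And>x. \<bar>\<phi> x\<bar> \<le> B" "B \<ge> 0"
proof -
  have "bounded (\<phi> ` closure {x. \<phi> x \<noteq> 0})"
    by (intro compact_imp_bounded compact_continuous_image
        continuous_on_subset[OF test_funD(3)[OF assms]] test_funD(4)[OF assms]) auto
  then obtain B where "B > 0" "\<And>x. x \<in> closure {x. \<phi> x \<noteq> 0} \<Longrightarrow> \<bar>\<phi> x\<bar> \<le> B"
    unfolding bounded_pos by auto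
  then have "\<bar>\<phi> x\<bar> \<le> B" for x
    using closure_subset[of "{x. \<phi> x \<noteq> 0}"] by (cases "\<phi> x = 0") auto
  with \<open>B > 0\<close> that show ?thesis by fastforce
qed

text \<open>A product of one-sided cutoffs, one for each face. The shift by -1 makes a factor vanish
  within distance 1/n of its face, so the support is a compact part of the open box. At a fixed
  interior point all arguments tend to infinity, where \<open>flat_exp 1\<close> tends to 1.\<close>

definition box_bump :: "real^2 \<Rightarrow> real^2 \<Rightarrow> nat \<Rightarrow> real^2 \<Rightarrow> real" where
  "box_bump a b n x = (\<Prod>j\<in>UNIV. flat_exp 1 (real n * (x $ j - a $ j) - 1)
                                * flat_exp 1 (real n * (b $ j - x $ j) - 1))"

lemma flat_exp_1_bounds: "0 \<le> flat_exp 1 t" "flat_exp 1 t \<le> 1"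
  by (auto simp: flat_exp_def)

lemma box_bump_bounds: "0 \<le> box_bump a b n x" "box_bump a b n x \<le> 1"
  unfolding box_bump_def
  by (auto intro!: prod_nonneg prod_le_1 mult_le_one simp: flat_exp_1_bounds)

lemma box_bump_test_fun:
  assumes "box a b \<subseteq> \<Omega>"
  shows "box_bump a b n \<in> test_fun \<Omega>"
\<comment> \<open>The case n = 0 is separate because 1 / 0 = 0 would turn \<open>?K\<close> below
  into the closed box, which may leave \<Omega>.\<close>
proof (cases "n = 0")
  case True
  then have "box_bump a b n = (\<lambda>x. 0)"
    by (auto simp: fun_eq_iff box_bump_def flat_exp_def)
  then show ?thesis by (simp add: test_fun_zero)
next
  case False
  show ?thesis
  proof (rule test_funI)
    show "C_k k (box_bump a b n)" for k
      unfolding box_bump_def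
      using C_k_flat_exp[of k 1 "real n" _ "- real n * a $ _ - 1"]
        C_k_flat_exp[of k 1 "- real n" _ "real n * b $ _ - 1"]
      by (intro C_k_prod C_k_mult) (auto simp: algebra_simps)
    let ?K = "cbox (\<chi> j. a $ j + 1 / n) (\<chi> j. b $ j - 1 / n)"
    show "{x. box_bump a b n x \<noteq> 0} \<subseteq> ?K"
    proof clarify
      fix x assume "box_bump a b n x \<noteq> 0"
      then have "real n * (x $ j - a $ j) - 1 > 0 \<and> real n * (b $ j - x $ j) - 1 > 0" for j
        unfolding box_bump_def by (auto simp: flat_exp_def split: if_splits)
      with False show "x \<in> ?K"
        by (auto simp: mem_box_cart field_simps less_imp_le)
    qed
    show "?K \<subseteq> \<Omega>"
    proof
      fix x assume "x \<in> ?K"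
      then have "a $ j + 1/n \<le> x $ j \<and> x $ j \<le> b $ j - 1/n" for j
        by (auto simp: mem_box_cart)
      moreover have "1 / real n > 0" using False by simp
      ultimately have "a $ j < x $ j \<and> x $ j < b $ j" for j
        by (smt (verit, best))
      then have "x \<in> box a b" by (auto simp: mem_box_cart)
      with assms show "x \<in> \<Omega>" by auto
    qed
  qed simp
qed

lemma flat_exp_1_limit:
  assumes "t > 0"
  shows "(\<lambda>n. flat_exp 1 (real n * t - 1)) \<longlonglongrightarrow> 1"
proof -
  have 1: "filterlim (\<lambda>n. real n * t - 1) at_top sequentially"
  proof -
    have "filterlim (\<lambda>n. t * real n) at_top sequentially"
      by (rule filterlim_tendsto_pos_mult_at_top[OF tendsto_const assms filterlim_real_sequentially])
    from filterlim_tendsto_add_at_top[OF tendsto_const[of "-1"] this]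
    show ?thesis by (simp add: mult.commute)
  qed
  have "(\<lambda>n. exp (- (inverse (real n * t - 1)))) \<longlonglongrightarrow> exp (- 0)"
    by (intro tendsto_intros filterlim_compose[OF tendsto_inverse_0_at_top 1] 
        tendsto_inverse_0_at_top 1)
  moreover have "eventually (\<lambda>n. real n * t - 1 > 0) sequentially"
    using 1 unfolding filterlim_at_top_dense by blast
  ultimately show ?thesis
    by (elim Lim_transform_eventually[rotated, OF eventually_mono])
       (auto simp: flat_exp_def inverse_eq_divide)
qed

lemma box_bump_limit: "(\<lambda>n. box_bump a b n x) \<longlonglongrightarrow> indicator (box a b) x"
proof (cases "x \<in> box a b")
  case True
  then have "(\<lambda>n. box_bump a b n x) \<longlonglongrightarrow> (\<Prod>j\<in>(UNIV::2 set). 1 * 1)"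
    unfolding box_bump_def
    by (intro tendsto_intros flat_exp_1_limit) (auto simp: mem_box_cart)
  with True show ?thesis by simp
next
  case False
  then have "box_bump a b n x = 0" for n
    using test_funD(6)[OF box_bump_test_fun[OF order_refl]] by blast
  with False show ?thesis by simp
qed

subsection \<open>The space \<open>L\<^sup>2\<close>\<close>

lemma L2I:
  assumes "f \<in> borel_measurable (lebesgue_on \<Omega>)" "integrable (lebesgue_on \<Omega>) (\<lambda>x. f x \<bullet> f x)"
  shows "f \<in> L2 \<Omega>"
  using assms by (simp add: L2_def power2_norm_eq_inner)

lemma L2_measurable: "f \<in> L2 \<Omega> \<Longrightarrow> f \<in> borel_measurable (lebesgue_on \<Omega>)"
  by (simp add: L2_def)

lemma L2_integrable_sq: "f \<in> L2 \<Omega> \<Longrightarrow> integrable (lebesgue_on \<Omega>) (\<lambda>x. f x \<bullet> f x)"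
  by (simp add: L2_def power2_norm_eq_inner)

text \<open>The majorant is |f|^2 + |g|^2, since ab \<le> a^2 + b^2 for nonnegative a and b.\<close>

lemma L2_integrable_inner:
  assumes "f \<in> L2 \<Omega>" "g \<in> L2 \<Omega>"
  shows "integrable (lebesgue_on \<Omega>) (\<lambda>x. f x \<bullet> g x)"
proof (rule Bochner_Integration.integrable_bound)
  show "integrable (lebesgue_on \<Omega>) (\<lambda>x. f x \<bullet> f x + g x \<bullet> g x)"
    by (intro Bochner_Integration.integrable_add L2_integrable_sq assms)
  show "(\<lambda>x. f x \<bullet> g x) \<in> borel_measurable (lebesgue_on \<Omega>)"
    by (intro borel_measurable_inner L2_measurable assms)
  have "norm (a \<bullet> b) \<le> norm (a \<bullet> a + b \<bullet> b)" for a b :: 'a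
  proof -
    have "norm (a \<bullet> b) \<le> norm a * norm b" by (simp add: Cauchy_Schwarz_ineq2)
    also have "\<dots> \<le> (norm a)\<^sup>2 + (norm b)\<^sup>2"
    proof -
      have "0 \<le> norm a * norm b" by simp
      with sum_squares_bound[of "norm a" "norm b"] show ?thesis by linarith
    qed
    finally show ?thesis by (simp add: power2_norm_eq_inner)
  qed
  then show "AE x in lebesgue_on \<Omega>. norm (f x \<bullet> g x) \<le> norm (f x \<bullet> f x + g x \<bullet> g x)" by simp
qed

lemma L2_add:
  assumes "f \<in> L2 \<Omega>" "g \<in> L2 \<Omega>"
  shows "(\<lambda>x. f x + g x) \<in> L2 \<Omega>"
proof (rule L2I)
  show "(\<lambda>x. f x + g x) \<in> borel_measurable (lebesgue_on \<Omega>)"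
    by (intro borel_measurable_add L2_measurable assms)
  have "(\<lambda>x. (f x + g x) \<bullet> (f x + g x)) = (\<lambda>x. f x \<bullet> f x + f x \<bullet> g x + (g x \<bullet> f x + g x \<bullet> g x))"
    by (simp add: inner_add_left inner_add_right algebra_simps)
  then show "integrable (lebesgue_on \<Omega>) (\<lambda>x. (f x + g x) \<bullet> (f x + g x))"
    using assms by (simp add: L2_integrable_inner)
qed

lemma L2_scaleR:
  assumes "f \<in> L2 \<Omega>"
  shows "(\<lambda>x. c *\<^sub>R f x) \<in> L2 \<Omega>"
proof (rule L2I)
  show "(\<lambda>x. c *\<^sub>R f x) \<in> borel_measurable (lebesgue_on \<Omega>)"
    using L2_measurable[OF assms] by simp
  show "integrable (lebesgue_on \<Omega>) (\<lambda>x. (c *\<^sub>R f x) \<bullet> (c *\<^sub>R f x))"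
    using assms by (simp add: L2_integrable_inner)
qed

lemma L2_cmult: "f \<in> L2 \<Omega> \<Longrightarrow> (\<lambda>x. c * f x) \<in> L2 \<Omega>" for f :: "real^2 \<Rightarrow> real"
  using L2_scaleR[of f \<Omega> c] by simp

lemma L2_uminus: "f \<in> L2 \<Omega> \<Longrightarrow> (\<lambda>x. - f x) \<in> L2 \<Omega>"
  using L2_scaleR[of f \<Omega> "-1"] by simp

lemma L2_diff: "f \<in> L2 \<Omega> \<Longrightarrow> g \<in> L2 \<Omega> \<Longrightarrow> (\<lambda>x. f x - g x) \<in> L2 \<Omega>"
  using L2_add[OF _ L2_uminus, of f \<Omega> g] by simp

lemma L2_zero: "(\<lambda>x. 0) \<in> L2 \<Omega>"
  by (simp add: L2_def)

lemma L2_inner_left: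
  fixes f :: "real^2 \<Rightarrow> 'a::euclidean_space"
  assumes "f \<in> L2 \<Omega>"
  shows "(\<lambda>x. f x \<bullet> a) \<in> L2 \<Omega>"
proof (rule L2I)
  show 1: "(\<lambda>x. f x \<bullet> a) \<in> borel_measurable (lebesgue_on \<Omega>)"
    using L2_measurable[OF assms] by simp
  show "integrable (lebesgue_on \<Omega>) (\<lambda>x. (f x \<bullet> a) \<bullet> (f x \<bullet> a))"
  proof (rule Bochner_Integration.integrable_bound)
    show "integrable (lebesgue_on \<Omega>) (\<lambda>x. (f x \<bullet> f x) * (a \<bullet> a))"
      using L2_integrable_sq[OF assms] by simp
    show "(\<lambda>x. (f x \<bullet> a) \<bullet> (f x \<bullet> a)) \<in> borel_measurable (lebesgue_on \<Omega>)"
      using 1 by simp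
    show "AE x in lebesgue_on \<Omega>. norm ((f x \<bullet> a) \<bullet> (f x \<bullet> a)) \<le> norm ((f x \<bullet> f x) * (a \<bullet> a))"
      using Cauchy_Schwarz_ineq[of "f _" a] by (simp add: power2_eq_square abs_mult)
  qed
qed

lemma L2_vec_nth: "f \<in> L2 \<Omega> \<Longrightarrow> (\<lambda>x. f x $ i) \<in> L2 \<Omega>" for f :: "real^2 \<Rightarrow> real^'n"
  using L2_inner_left[of f \<Omega> "axis i 1"] by (simp add: inner_axis)

lemma L2_vec_lambda:
  fixes f :: "'n::finite \<Rightarrow> real^2 \<Rightarrow> real"
  assumes "\<And>i. f i \<in> L2 \<Omega>"
  shows "(\<lambda>x. \<chi> i. f i x) \<in> L2 \<Omega>"
proof (rule L2I)
  show "(\<lambda>x. \<chi> i. f i x) \<in> borel_measurable (lebesgue_on \<Omega>)"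
    using L2_measurable[OF assms]
    by (subst borel_measurable_euclidean_space) (auto simp: Basis_vec_def inner_axis)
  show "integrable (lebesgue_on \<Omega>) (\<lambda>x. (\<chi> i. f i x) \<bullet> (\<chi> i. f i x))"
    using L2_integrable_inner[OF assms assms] by (simp add: inner_vec_def)
qed

lemma L2_inner_commute: "L2_inner \<Omega> f g = L2_inner \<Omega> g f"
  by (simp add: L2_inner_def inner_commute)

lemma L2_inner_add_left:
  "\<lbrakk>f \<in> L2 \<Omega>; g \<in> L2 \<Omega>; h \<in> L2 \<Omega>\<rbrakk>
    \<Longrightarrow> L2_inner \<Omega> (\<lambda>x. f x + g x) h = L2_inner \<Omega> f h + L2_inner \<Omega> g h"
  by (simp add: L2_inner_def inner_add_left L2_integrable_inner)

lemma L2_inner_diff_left: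
  "\<lbrakk>f \<in> L2 \<Omega>; g \<in> L2 \<Omega>; h \<in> L2 \<Omega>\<rbrakk>
    \<Longrightarrow> L2_inner \<Omega> (\<lambda>x. f x - g x) h = L2_inner \<Omega> f h - L2_inner \<Omega> g h"
  by (simp add: L2_inner_def inner_diff_left L2_integrable_inner)

lemma L2_inner_scaleR_left: "L2_inner \<Omega> (\<lambda>x. c *\<^sub>R f x) h = c * L2_inner \<Omega> f h"
  by (simp add: L2_inner_def)

lemma L2_inner_cmult_left: "L2_inner \<Omega> (\<lambda>x. c * f x) h = c * L2_inner \<Omega> f h"
  for f :: "real^2 \<Rightarrow> real"
  using L2_inner_scaleR_left[of \<Omega> c f h] by simp

lemma L2_inner_add_right:
  "\<lbrakk>f \<in> L2 \<Omega>; g \<in> L2 \<Omega>; h \<in> L2 \<Omega>\<rbrakk>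
    \<Longrightarrow> L2_inner \<Omega> h (\<lambda>x. f x + g x) = L2_inner \<Omega> h f + L2_inner \<Omega> h g"
  by (simp add: L2_inner_commute[of \<Omega> h] L2_inner_add_left)

lemma L2_inner_diff_right:
  "\<lbrakk>f \<in> L2 \<Omega>; g \<in> L2 \<Omega>; h \<in> L2 \<Omega>\<rbrakk>
    \<Longrightarrow> L2_inner \<Omega> h (\<lambda>x. f x - g x) = L2_inner \<Omega> h f - L2_inner \<Omega> h g"
  by (simp add: L2_inner_commute[of \<Omega> h] L2_inner_diff_left)

lemma L2_inner_scaleR_right: "L2_inner \<Omega> h (\<lambda>x. c *\<^sub>R f x) = c * L2_inner \<Omega> h f"
  by (simp add: L2_inner_def)

lemma L2_inner_cmult_right: "L2_inner \<Omega> h (\<lambda>x. c * f x) = c * L2_inner \<Omega> h f"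
  for f :: "real^2 \<Rightarrow> real"
  using L2_inner_scaleR_right[of \<Omega> h c f] by simp

lemma L2_inner_vec:
  fixes f g :: "real^2 \<Rightarrow> real^'n"
  assumes "f \<in> L2 \<Omega>" "g \<in> L2 \<Omega>"
  shows "L2_inner \<Omega> f g = (\<Sum>i\<in>UNIV. L2_inner \<Omega> (\<lambda>x. f x $ i) (\<lambda>x. g x $ i))"
proof -
  have "integrable (lebesgue_on \<Omega>) (\<lambda>x. f x $ i * g x $ i)" for i
    using L2_integrable_inner[OF L2_vec_nth[OF assms(1)] L2_vec_nth[OF assms(2)], of i i] by simp
  then show ?thesis by (simp add: L2_inner_def inner_vec_def)
qed

lemma L2_inner_cong:
  assumes "ae_eq \<Omega> f f'" "ae_eq \<Omega> g g'" "f \<in> L2 \<Omega>" "f' \<in> L2 \<Omega>" "g \<in> L2 \<Omega>" "g' \<in> L2 \<Omega>"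
  shows "L2_inner \<Omega> f g = L2_inner \<Omega> f' g'"
  unfolding L2_inner_def
proof (rule integral_cong_AE)
  show "AE x in lebesgue_on \<Omega>. f x \<bullet> g x = f' x \<bullet> g' x"
    using assms(1,2) unfolding ae_eq_def by eventually_elim simp
qed (intro borel_measurable_inner L2_measurable assms)+

lemma L2_inner_self_nonneg: "0 \<le> L2_inner \<Omega> f f"
  by (simp add: L2_inner_def)

lemma L2_norm_nonneg: "0 \<le> L2_norm \<Omega> f"
  by (simp add: L2_norm_def L2_inner_self_nonneg)

lemma L2_norm_power2: "(L2_norm \<Omega> f)\<^sup>2 = L2_inner \<Omega> f f"
  by (simp add: L2_norm_def L2_inner_self_nonneg)

lemma L2_norm_scaleR: "L2_norm \<Omega> (\<lambda>x. c *\<^sub>R f x) = \<bar>c\<bar> * L2_norm \<Omega> f"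
  by (simp add: L2_norm_def L2_inner_scaleR_left L2_inner_scaleR_right real_sqrt_mult
      flip: mult.assoc power2_eq_square)

lemma L2_norm_cmult: "L2_norm \<Omega> (\<lambda>x. c * f x) = \<bar>c\<bar> * L2_norm \<Omega> f" for f :: "real^2 \<Rightarrow> real"
  using L2_norm_scaleR[of \<Omega> c f] by simp

lemma L2_norm_cong:
  "\<lbrakk>ae_eq \<Omega> f g; f \<in> L2 \<Omega>; g \<in> L2 \<Omega>\<rbrakk> \<Longrightarrow> L2_norm \<Omega> f = L2_norm \<Omega> g"
  unfolding L2_norm_def by (subst L2_inner_cong[of \<Omega> f g f g]) auto

text \<open>The discriminant argument, with a homogeneous quadratic form in s and t. The elements of
  \<open>L2\<close> are functions and not classes, so the form is only semidefinite and C = 0 does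
  not make g vanish identically; that case has its own choice of s and t.\<close>

lemma L2_Cauchy_Schwarz:
  assumes f: "f \<in> L2 \<Omega>" and g: "g \<in> L2 \<Omega>"
  shows "\<bar>L2_inner \<Omega> f g\<bar> \<le> L2_norm \<Omega> f * L2_norm \<Omega> g"
proof -
  define A B C where "A = L2_inner \<Omega> f f" and "B = L2_inner \<Omega> f g" and "C = L2_inner \<Omega> g g"
  have pos: "0 \<le> s\<^sup>2 * A - 2 * s * t * B + t\<^sup>2 * C" for s t
  proof -
    have "0 \<le> L2_inner \<Omega> (\<lambda>x. s *\<^sub>R f x - t *\<^sub>R g x) (\<lambda>x. s *\<^sub>R f x - t *\<^sub>R g x)"
      by (rule L2_inner_self_nonneg)
    also have "\<dots> = s\<^sup>2 * A - 2 * s * t * B + t\<^sup>2 * C"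
      using f g unfolding A_def B_def C_def
      by (simp add: L2_inner_diff_left L2_inner_diff_right L2_diff L2_scaleR L2_inner_scaleR_left
          L2_inner_scaleR_right L2_inner_commute[of \<Omega> g f] power2_eq_square algebra_simps)
    finally show ?thesis .
  qed
  have "A \<ge> 0" "C \<ge> 0" by (simp_all add: A_def C_def L2_inner_self_nonneg)
  have "B\<^sup>2 \<le> A * C"
  proof (cases "C = 0")
    case True
    have "B = 0"
    proof (rule ccontr)
      assume "B \<noteq> 0"
      \<comment> \<open>These values turn the form into A - (A + 1) = -1.\<close>
      with pos[of 1 "(A + 1) / (2 * B)"] True show False by simp
    qed
    with True show ?thesis by simp
  next
    case False
    have "0 \<le> C * (A * C - B\<^sup>2)"
      \<comment> \<open>At s = C and t = B the form factors as C (A C - B^2).\<close>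
      using pos[of C B] by (simp add: power2_eq_square algebra_simps)
    with False \<open>C \<ge> 0\<close> show ?thesis by (simp add: zero_le_mult_iff)
  qed
  then have "sqrt (B\<^sup>2) \<le> sqrt (A * C)" by (rule real_sqrt_le_mono)
  then show ?thesis
    by (simp add: L2_norm_def A_def B_def C_def real_sqrt_mult)
qed

lemma L2_norm_triangle:
  assumes f: "f \<in> L2 \<Omega>" and g: "g \<in> L2 \<Omega>"
  shows "L2_norm \<Omega> (\<lambda>x. f x + g x) \<le> L2_norm \<Omega> f + L2_norm \<Omega> g"
proof (rule power2_le_imp_le)
  have "(L2_norm \<Omega> (\<lambda>x. f x + g x))\<^sup>2 = (L2_norm \<Omega> f)\<^sup>2 + 2 * L2_inner \<Omega> f g + (L2_norm \<Omega> g)\<^sup>2"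
    using f g by (simp add: L2_norm_power2 L2_inner_add_left L2_inner_add_right L2_add
        L2_inner_commute[of \<Omega> g f])
  also have "\<dots> \<le> (L2_norm \<Omega> f + L2_norm \<Omega> g)\<^sup>2"
    using L2_Cauchy_Schwarz[OF f g] by (simp add: power2_sum)
  finally show "(L2_norm \<Omega> (\<lambda>x. f x + g x))\<^sup>2 \<le> (L2_norm \<Omega> f + L2_norm \<Omega> g)\<^sup>2" .
qed (simp add: L2_norm_nonneg)

lemma L2_norm_triangle_diff:
  assumes "f \<in> L2 \<Omega>" "g \<in> L2 \<Omega>"
  shows "L2_norm \<Omega> (\<lambda>x. f x - g x) \<le> L2_norm \<Omega> f + L2_norm \<Omega> g"
  using L2_norm_triangle[OF assms(1) L2_uminus[OF assms(2)]] L2_norm_scaleR[of \<Omega> "-1" g] by simp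

lemma L2_norm_eq_0D:
  assumes "f \<in> L2 \<Omega>" "L2_norm \<Omega> f = 0"
  shows "ae_eq \<Omega> f (\<lambda>x. 0)"
proof -
  have "(LINT x|lebesgue_on \<Omega>. f x \<bullet> f x) = 0"
    using assms(2) by (simp add: L2_norm_def L2_inner_def)
  then have "AE x in lebesgue_on \<Omega>. f x \<bullet> f x = 0"
    using integral_nonneg_eq_0_iff_AE[OF L2_integrable_sq[OF assms(1)]] by simp
  then show ?thesis by (simp add: ae_eq_def)
qed

lemma ae_eq_refl: "ae_eq \<Omega> f f"
  by (simp add: ae_eq_def)

text \<open>Membership in \<open>L2\<close> is part of the notion: the integral of a non-integrable
  function is 0 by convention, so small values of \<open>L2_norm\<close> alone would say
  nothing.\<close>

definition L2_lim :: "(real^2) set \<Rightarrow> (nat \<Rightarrow> real^2 \<Rightarrow> 'a::euclidean_space) \<Rightarrow> (real^2 \<Rightarrow> 'a) \<Rightarrow> bool" where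
  "L2_lim \<Omega> F f \<longleftrightarrow> (\<forall>n. F n \<in> L2 \<Omega>) \<and> f \<in> L2 \<Omega> \<and> (\<lambda>n. L2_norm \<Omega> (\<lambda>x. F n x - f x)) \<longlonglongrightarrow> 0"

text \<open>The means by which identities between test functions reach their limits. The difference
  is expanded around f and g into three terms, each controlled by the Cauchy-Schwarz
  inequality.\<close>

lemma L2_lim_inner:
  assumes "L2_lim \<Omega> F f" "L2_lim \<Omega> G g"
  shows "(\<lambda>n. L2_inner \<Omega> (F n) (G n)) \<longlonglongrightarrow> L2_inner \<Omega> f g"
proof -
  have F: "F n \<in> L2 \<Omega>" "f \<in> L2 \<Omega>" "(\<lambda>x. F n x - f x) \<in> L2 \<Omega>" 
   and G: "G n \<in> L2 \<Omega>" "g \<in> L2 \<Omega>" "(\<lambda>x. G n x - g x) \<in> L2 \<Omega>" for n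
    using assms by (auto simp: L2_lim_def L2_diff)
  define a b where "a = (\<lambda>n. L2_norm \<Omega> (\<lambda>x. F n x - f x))" and "b = (\<lambda>n. L2_norm \<Omega> (\<lambda>x. G n x - g x))"
  have ab: "a \<longlonglongrightarrow> 0" "b \<longlonglongrightarrow> 0"
    using assms by (auto simp: L2_lim_def a_def b_def)
  have "norm (L2_inner \<Omega> (F n) (G n) - L2_inner \<Omega> f g)
      \<le> a n * b n + a n * L2_norm \<Omega> g + L2_norm \<Omega> f * b n" for n
  proof -
    have "L2_inner \<Omega> (F n) (G n) - L2_inner \<Omega> f g
        = L2_inner \<Omega> (\<lambda>x. F n x - f x) (\<lambda>x. G n x - g x) + L2_inner \<Omega> (\<lambda>x. F n x - f x) g
          + L2_inner \<Omega> f (\<lambda>x. G n x - g x)"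
      using F G by (simp add: L2_inner_diff_left L2_inner_diff_right)
    then show ?thesis
      using L2_Cauchy_Schwarz[OF F(3)[of n] G(3)[of n]] L2_Cauchy_Schwarz[OF F(3)[of n] G(2)]
        L2_Cauchy_Schwarz[OF F(2) G(3)[of n]] by (simp add: a_def b_def)
  qed
  moreover have "(\<lambda>n. a n * b n + a n * L2_norm \<Omega> g + L2_norm \<Omega> f * b n) \<longlonglongrightarrow>
      0 * 0 + 0 * L2_norm \<Omega> g + L2_norm \<Omega> f * 0"
    by (intro tendsto_intros ab)
  ultimately have "(\<lambda>n. L2_inner \<Omega> (F n) (G n) - L2_inner \<Omega> f g) \<longlonglongrightarrow> 0"
    by - (rule Lim_null_comparison[OF always_eventually], auto)
  then show ?thesis by (rule LIM_zero_cancel)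
qed

lemma L2_lim_const: "f \<in> L2 \<Omega> \<Longrightarrow> L2_lim \<Omega> (\<lambda>n. f) f"
  by (simp add: L2_lim_def L2_norm_def L2_inner_def)

lemma L2_lim_add:
  assumes "L2_lim \<Omega> F f" "L2_lim \<Omega> G g"
  shows "L2_lim \<Omega> (\<lambda>n x. F n x + G n x) (\<lambda>x. f x + g x)"
  unfolding L2_lim_def
proof (intro conjI allI)
  have F: "F n \<in> L2 \<Omega>" "f \<in> L2 \<Omega>" "(\<lambda>x. F n x - f x) \<in> L2 \<Omega>" 
   and G: "G n \<in> L2 \<Omega>" "g \<in> L2 \<Omega>" "(\<lambda>x. G n x - g x) \<in> L2 \<Omega>" for n
    using assms by (auto simp: L2_lim_def L2_diff)
  show "(\<lambda>x. F n x + G n x) \<in> L2 \<Omega>" "(\<lambda>x. f x + g x) \<in> L2 \<Omega>" for n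
    using F G by (simp_all add: L2_add)
  have "L2_norm \<Omega> (\<lambda>x. F n x + G n x - (f x + g x))
      \<le> L2_norm \<Omega> (\<lambda>x. F n x - f x) + L2_norm \<Omega> (\<lambda>x. G n x - g x)" for n
    using L2_norm_triangle[OF F(3)[of n] G(3)[of n]] by (simp add: algebra_simps)
  moreover have "(\<lambda>n. L2_norm \<Omega> (\<lambda>x. F n x - f x) + L2_norm \<Omega> (\<lambda>x. G n x - g x)) \<longlonglongrightarrow> 0 + 0"
    using assms by (intro tendsto_add) (auto simp: L2_lim_def)
  ultimately show "(\<lambda>n. L2_norm \<Omega> (\<lambda>x. F n x + G n x - (f x + g x))) \<longlonglongrightarrow> 0"
    by - (rule Lim_null_comparison[OF always_eventually], auto simp: L2_norm_nonneg)
qed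

lemma L2_lim_scaleR:
  assumes "L2_lim \<Omega> F f"
  shows "L2_lim \<Omega> (\<lambda>n x. c *\<^sub>R F n x) (\<lambda>x. c *\<^sub>R f x)"
  using assms tendsto_mult[OF tendsto_const[of "\<bar>c\<bar>"], of "\<lambda>n. L2_norm \<Omega> (\<lambda>x. F n x - f x)" 0]
  by (auto simp: L2_lim_def L2_scaleR L2_norm_scaleR simp flip: scaleR_right_diff_distrib)

lemma L2_lim_diff:
  assumes "L2_lim \<Omega> F f" "L2_lim \<Omega> G g"
  shows "L2_lim \<Omega> (\<lambda>n x. F n x - G n x) (\<lambda>x. f x - g x)"
  using L2_lim_add[OF assms(1) L2_lim_scaleR[OF assms(2), of "-1"]] by simp

lemma L2_norm_vec_nth_le:
  fixes f :: "real^2 \<Rightarrow> real^'n"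
  assumes "f \<in> L2 \<Omega>"
  shows "L2_norm \<Omega> (\<lambda>x. f x $ i) \<le> L2_norm \<Omega> f"
proof -
  have "(L2_norm \<Omega> (\<lambda>x. f x $ i))\<^sup>2 \<le> (\<Sum>i\<in>UNIV. (L2_norm \<Omega> (\<lambda>x. f x $ i))\<^sup>2)"
    by (rule member_le_sum) auto
  also have "\<dots> = (L2_norm \<Omega> f)\<^sup>2"
    by (simp add: L2_norm_power2 L2_inner_vec[OF assms assms])
  finally show ?thesis by (rule power2_le_imp_le) (rule L2_norm_nonneg)
qed

lemma L2_lim_vec_nth:
  fixes F :: "nat \<Rightarrow> real^2 \<Rightarrow> real^'n"
  assumes "L2_lim \<Omega> F f"
  shows "L2_lim \<Omega> (\<lambda>n x. F n x $ i) (\<lambda>x. f x $ i)"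
  unfolding L2_lim_def
proof (intro conjI allI)
  have "norm (L2_norm \<Omega> (\<lambda>x. F n x $ i - f x $ i)) \<le> L2_norm \<Omega> (\<lambda>x. F n x - f x)" for n
    using L2_norm_vec_nth_le[of "\<lambda>x. F n x - f x" \<Omega> i] assms
    by (simp add: L2_lim_def L2_diff L2_norm_nonneg)
  then show "(\<lambda>n. L2_norm \<Omega> (\<lambda>x. F n x $ i - f x $ i)) \<longlonglongrightarrow> 0"
    using assms
    by - (rule Lim_null_comparison[where g="\<lambda>n. L2_norm \<Omega> (\<lambda>x. F n x - f x)",
          OF always_eventually], auto simp: L2_lim_def)
qed (use assms in \<open>auto simp: L2_lim_def L2_vec_nth\<close>)

lemma L2_norm_le_sum_vec_nth:
  fixes f :: "real^2 \<Rightarrow> real^'n"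
  assumes "f \<in> L2 \<Omega>"
  shows "L2_norm \<Omega> f \<le> (\<Sum>i\<in>UNIV. L2_norm \<Omega> (\<lambda>x. f x $ i))"
proof -
  have "L2_norm \<Omega> f = L2_set (\<lambda>i. L2_norm \<Omega> (\<lambda>x. f x $ i)) UNIV"
    by (simp add: L2_norm_def[of \<Omega> f] L2_set_def L2_inner_vec[OF assms assms] L2_norm_power2)
  also have "\<dots> \<le> (\<Sum>i\<in>UNIV. L2_norm \<Omega> (\<lambda>x. f x $ i))"
    by (rule L2_set_le_sum) (simp add: L2_norm_nonneg)
  finally show ?thesis .
qed

lemma L2_lim_vec_lambda:
  fixes F :: "'n::finite \<Rightarrow> nat \<Rightarrow> real^2 \<Rightarrow> real"
  assumes "\<And>i. L2_lim \<Omega> (F i) (f i)"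
  shows "L2_lim \<Omega> (\<lambda>n x. \<chi> i. F i n x) (\<lambda>x. \<chi> i. f i x)"
  unfolding L2_lim_def
proof (intro conjI allI)
  have F: "F i n \<in> L2 \<Omega>" "f i \<in> L2 \<Omega>" "(\<lambda>n. L2_norm \<Omega> (\<lambda>x. F i n x - f i x)) \<longlonglongrightarrow> 0" for i n
    using assms by (auto simp: L2_lim_def)
  show *: "(\<lambda>x. \<chi> i. F i n x) \<in> L2 \<Omega>" "(\<lambda>x. \<chi> i. f i x) \<in> L2 \<Omega>" for n
    by (intro L2_vec_lambda F)+
  have "(\<lambda>n. \<Sum>i\<in>UNIV. L2_norm \<Omega> (\<lambda>x. F i n x - f i x)) \<longlonglongrightarrow> (\<Sum>i\<in>(UNIV::'n set). 0)"
    by (intro tendsto_sum F)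
  then show "(\<lambda>n. L2_norm \<Omega> (\<lambda>x. (\<chi> i. F i n x) - (\<chi> i. f i x))) \<longlonglongrightarrow> 0"
    using L2_norm_le_sum_vec_nth[OF L2_diff[OF *(1) *(2)]]
    by - (rule Lim_null_comparison[OF always_eventually], auto simp: L2_norm_nonneg)
qed

definition L2_Cauchy :: "(real^2) set \<Rightarrow> (nat \<Rightarrow> real^2 \<Rightarrow> 'a::euclidean_space) \<Rightarrow> bool" where
  "L2_Cauchy \<Omega> F \<longleftrightarrow> (\<forall>n. F n \<in> L2 \<Omega>) \<and>
     (\<forall>e>0. \<exists>N. \<forall>m\<ge>N. \<forall>n\<ge>N. L2_norm \<Omega> (\<lambda>x. F m x - F n x) < e)"

subsection \<open>Integration by parts\<close>

lemma partial_deriv_line: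
  assumes "f differentiable (at (x + t *\<^sub>R axis i 1))"
  shows "((\<lambda>t. f (x + t *\<^sub>R axis i 1)) has_real_derivative
    partial_deriv i f (x + t *\<^sub>R axis i 1)) (at t)"
proof -
  let ?D = "frechet_derivative f (at (x + t *\<^sub>R axis i 1))"
  have D: "(f has_derivative ?D) (at (x + t *\<^sub>R axis i 1))"
    using assms by (simp add: frechet_derivative_works)
  have "((\<lambda>t. x + t *\<^sub>R axis i 1) has_derivative (\<lambda>h. h *\<^sub>R axis i 1)) (at t)"
    by (auto intro!: derivative_eq_intros)
  from has_derivative_compose[OF this D]
  have "((\<lambda>t. f (x + t *\<^sub>R axis i 1)) has_derivative (\<lambda>h. ?D (h *\<^sub>R axis i 1))) (at t)" .
  moreover have "?D (h *\<^sub>R axis i 1) = partial_deriv i f (x + t *\<^sub>R axis i 1) * h" for h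
    using linear_scale[OF has_derivative_linear[OF D]] by (simp add: partial_deriv_def)
  ultimately show ?thesis by (simp add: has_field_derivative_def)
qed

lemma difference_quotient_tendsto:
  assumes "f differentiable (at x)" "h \<longlonglongrightarrow> 0" "\<And>n. h n \<noteq> 0"
  shows "(\<lambda>n. (f (x + h n *\<^sub>R axis i 1) - f x) / h n) \<longlonglongrightarrow> partial_deriv i f x"
proof -
  have "((\<lambda>h. (f (x + h *\<^sub>R axis i 1) - f x) / h) \<longlongrightarrow> partial_deriv i f x) (at 0)"
    using partial_deriv_line[of f x 0 i] assms(1) by (simp add: DERIV_def)
  moreover have "filterlim h (at 0) sequentially"
    using assms(2,3) by (simp add: filterlim_at)
  ultimately show ?thesis by (rule filterlim_compose)
qed

lemma test_fun_Lipschitz: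
  assumes "\<phi> \<in> test_fun \<Omega>"
  obtains B where "B \<ge> 0" "\<And>x h. \<bar>\<phi> (x + h *\<^sub>R axis i 1) - \<phi> x\<bar> \<le> B * \<bar>h\<bar>"
proof -
  obtain B where B: "\<And>x. \<bar>partial_deriv i \<phi> x\<bar> \<le> B" "B \<ge> 0"
    using test_fun_bounded[OF test_fun_partial_deriv[OF assms]] by metis
  have "norm (\<phi> (x + h *\<^sub>R axis i 1) - \<phi> (x + 0 *\<^sub>R axis i 1)) \<le> B * norm (h - 0)" for x h
    by (rule field_differentiable_bound[of UNIV "\<lambda>t. \<phi> (x + t *\<^sub>R axis i 1)"
          "\<lambda>t. partial_deriv i \<phi> (x + t *\<^sub>R axis i 1)" B h 0])
       (auto intro: partial_deriv_line test_funD[OF assms] B)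
  with that[OF B(2)] show ?thesis by simp
qed

lemma test_fun_borel_measurable: "\<phi> \<in> test_fun \<Omega> \<Longrightarrow> \<phi> \<in> borel_measurable borel"
  using test_funD(3) borel_measurable_continuous_onI by blast

lemma test_fun_integrable:
  assumes "\<phi> \<in> test_fun \<Omega>"
  shows "integrable lborel \<phi>"
proof -
  let ?K = "closure {x. \<phi> x \<noteq> 0}"
  have "integrable lborel (\<lambda>x. indicator ?K x *\<^sub>R \<phi> x)"
    by (intro borel_integrable_compact test_funD[OF assms]
        continuous_on_subset[OF test_funD(3)[OF assms]]) auto
  moreover have "(\<lambda>x. indicator ?K x *\<^sub>R \<phi> x) = \<phi>"
  proof
    fix x show "indicator ?K x *\<^sub>R \<phi> x = \<phi> x"
      using closure_subset[of "{x. \<phi> x \<noteq> 0}"] by (cases "\<phi> x = 0") (auto simp: subset_eq)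
  qed
  ultimately show ?thesis by (simp only:)
qed

lemma lborel_integral_translate:
  fixes f :: "'a::euclidean_space \<Rightarrow> real"
  assumes "f \<in> borel_measurable borel"
  shows "(LINT x|lborel. f (x + h)) = (LINT x|lborel. f x)"
proof -
  have "(LINT x|lborel. f x) = (LINT x|distr lborel borel ((+) h). f x)"
    by (simp add: lborel_distr_plus)
  also have "\<dots> = (LINT x|lborel. f (h + x))"
    by (rule integral_distr) (use assms in auto)
  finally show ?thesis by (simp add: add.commute)
qed

text \<open>Dominated convergence: a test function is Lipschitz along each axis, so a multiple of
  |\<eta>| is a majorant. The weight \<eta> will be the indicator of a ball for the mean of a
  derivative, and a partial derivative for the interchange of two derivatives.\<close>

lemma integral_difference_quotient_tendsto:
  assumes \<phi>: "\<phi> \<in> test_fun \<Omega>" and \<eta>: "integrable lborel \<eta>"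
    and h: "h \<longlonglongrightarrow> 0" "\<And>n. h n \<noteq> 0"
  shows "(\<lambda>n. LINT x|lborel. \<eta> x * ((\<phi> (x + h n *\<^sub>R axis i 1) - \<phi> x) / h n))
    \<longlonglongrightarrow> (LINT x|lborel. \<eta> x * partial_deriv i \<phi> x)"
proof -
  obtain B where B: "B \<ge> 0" "\<And>x h. \<bar>\<phi> (x + h *\<^sub>R axis i 1) - \<phi> x\<bar> \<le> B * \<bar>h\<bar>"
    using test_fun_Lipschitz[OF \<phi>] by metis
  note [measurable] = test_fun_borel_measurable[OF \<phi>]
    test_fun_borel_measurable[OF test_fun_partial_deriv[OF \<phi>]] borel_measurable_integrable[OF \<eta>]
  show ?thesis
  proof (rule integral_dominated_convergence)
    show "integrable lborel (\<lambda>x. B * \<bar>\<eta> x\<bar>)" using \<eta> by simp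
    show "AE x in lborel. (\<lambda>n. \<eta> x * ((\<phi> (x + h n *\<^sub>R axis i 1) - \<phi> x) / h n))
        \<longlonglongrightarrow> \<eta> x * partial_deriv i \<phi> x"
      by (intro AE_I2 tendsto_mult_left difference_quotient_tendsto test_funD[OF \<phi>] h)
    have "\<bar>(\<phi> (x + h n *\<^sub>R axis i 1) - \<phi> x) / h n\<bar> \<le> B" for x n
      using B(2)[of x "h n"] h(2)[of n] by (simp add: divide_le_eq)
    then show "AE x in lborel. norm (\<eta> x * ((\<phi> (x + h n *\<^sub>R axis i 1) - \<phi> x) / h n)) \<le> B * \<bar>\<eta> x\<bar>" for n
      by (intro AE_I2) (simp only: real_norm_def abs_mult mult.commute[of B] mult_left_mono abs_ge_zero)
  qed measurable
qed

text \<open>By translation invariance every difference quotient of a test function integrates to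
  zero, hence so does the limit of the quotients.\<close>

lemma integral_partial_deriv_eq_0:
  assumes "\<phi> \<in> test_fun \<Omega>"
  shows "(LINT x|lborel. partial_deriv i \<phi> x) = 0"
proof -
  obtain R where R: "\<And>x. x \<in> closure {x. \<phi> x \<noteq> 0} \<Longrightarrow> norm x \<le> R"
    using compact_imp_bounded[OF test_funD(4)[OF assms]] unfolding bounded_iff by metis
  have out: "\<phi> x = 0" if "norm x > R" for x
  proof (rule ccontr)
    assume "\<phi> x \<noteq> 0"
    then have "x \<in> closure {x. \<phi> x \<noteq> 0}"
      using closure_subset[of "{x. \<phi> x \<noteq> 0}"] by blast
    with R[of x] that show False by simp
  qed
  have out': "partial_deriv i \<phi> x = 0" if "norm x > R" for x
  proof -
    have "(\<phi> has_derivative (\<lambda>x. 0)) (at x)"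
      by (rule has_derivative_transform_within_open[where f="\<lambda>x. 0" and s="- cball 0 R"])
         (use that in \<open>auto simp: out\<close>)
    from partial_deriv_eq[OF this] show ?thesis by simp
  qed
  \<comment> \<open>The steps have length at most 1, so outside the ball of radius R + 1 both x and
    its translate lie where \<phi> vanishes. The integrable cutoff thus leaves every quotient
    unchanged.\<close>
  define \<eta> :: "real^2 \<Rightarrow> real" where "\<eta> = indicator (cball 0 (R + 1))"
  define h :: "nat \<Rightarrow> real" where "h n = 1 / Suc n" for n
  have h: "h \<longlonglongrightarrow> 0" "h n \<noteq> 0" "\<bar>h n\<bar> \<le> 1" for n
    using LIMSEQ_inverse_real_of_nat by (auto simp: h_def[abs_def] inverse_eq_divide)
  have "emeasure lborel (cball 0 (R + 1) :: (real^2) set) < \<infinity>"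
    by (rule emeasure_bounded_finite) simp
  then have "integrable lborel \<eta>" unfolding \<eta>_def by simp
  from integral_difference_quotient_tendsto[OF assms this h(1,2), of i]
  have "(\<lambda>n. LINT x|lborel. \<eta> x * ((\<phi> (x + h n *\<^sub>R axis i 1) - \<phi> x) / h n))
    \<longlonglongrightarrow> (LINT x|lborel. \<eta> x * partial_deriv i \<phi> x)" by simp
  moreover have "(\<lambda>x. \<eta> x * partial_deriv i \<phi> x) = partial_deriv i \<phi>"
  proof
    fix x show "\<eta> x * partial_deriv i \<phi> x = partial_deriv i \<phi> x"
      using out'[of x] by (cases "norm x \<le> R + 1") (auto simp: \<eta>_def)
  qed
  moreover have "(LINT x|lborel. \<eta> x * ((\<phi> (x + h n *\<^sub>R axis i 1) - \<phi> x) / h n)) = 0" for n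
  proof -
    have "\<eta> x * ((\<phi> (x + h n *\<^sub>R axis i 1) - \<phi> x) / h n)
        = (\<phi> (x + h n *\<^sub>R axis i 1) - \<phi> x) / h n" for x
    proof (cases "norm x \<le> R + 1")
      case False
      then have "norm (x + h n *\<^sub>R axis i 1) > R"
        using norm_triangle_ineq2[of x "- h n *\<^sub>R axis i 1"] h(3)[of n] by (simp add: norm_axis_1)
      with False show ?thesis by (simp add: out)
    qed (simp add: \<eta>_def)
    then have "(LINT x|lborel. \<eta> x * ((\<phi> (x + h n *\<^sub>R axis i 1) - \<phi> x) / h n))
        = (LINT x|lborel. (\<phi> (x + h n *\<^sub>R axis i 1) - \<phi> x) / h n)" by (simp only:)
    moreover have "integrable lborel (\<lambda>x. \<phi> (x + h n *\<^sub>R axis i 1))"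
      using assms test_fun_mono[of \<Omega> UNIV] by (intro test_fun_integrable[OF test_fun_translate]) auto
    ultimately show ?thesis
      using lborel_integral_translate[OF test_fun_borel_measurable[OF assms]] test_fun_integrable[OF assms]
      by simp
  qed
  ultimately have "(\<lambda>n::nat. 0) \<longlonglongrightarrow> (LINT x|lborel. partial_deriv i \<phi> x)"
    by (simp only:)
  then show ?thesis by (simp add: LIMSEQ_const_iff)
qed

lemma test_fun_mult: "\<lbrakk>\<phi> \<in> test_fun \<Omega>; \<psi> \<in> test_fun \<Omega>'\<rbrakk> \<Longrightarrow> (\<lambda>x. \<phi> x * \<psi> x) \<in> test_fun \<Omega>'"
  by (intro test_fun_mult_left) (auto intro: test_funD)

lemma integral_by_parts_test_fun:
  assumes "\<phi> \<in> test_fun \<Omega>" "\<psi> \<in> test_fun \<Omega>'"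
  shows "(LINT x|lborel. \<phi> x * partial_deriv i \<psi> x) = - (LINT x|lborel. partial_deriv i \<phi> x * \<psi> x)"
proof -
  have "partial_deriv i (\<lambda>x. \<phi> x * \<psi> x) x = \<phi> x * partial_deriv i \<psi> x + partial_deriv i \<phi> x * \<psi> x" for x
    by (intro partial_deriv_mult test_funD[OF assms(1)] test_funD[OF assms(2)])
  moreover have "integrable lborel (\<lambda>x. \<phi> x * partial_deriv i \<psi> x)"
    "integrable lborel (\<lambda>x. partial_deriv i \<phi> x * \<psi> x)"
    by (rule test_fun_integrable[OF test_fun_mult], rule assms, rule test_fun_partial_deriv, rule assms)
       (rule test_fun_integrable[OF test_fun_mult], rule test_fun_partial_deriv, (rule assms)+)
  ultimately show ?thesis
    using integral_partial_deriv_eq_0[OF test_fun_mult[OF assms], of i] by simp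
qed

text \<open>Differentiating \<open>\<integral> \<partial>\<^sub>i\<phi>(x) \<psi>(x + h e\<^sub>j) dx = - \<integral> \<phi>(x - h e\<^sub>j) \<partial>\<^sub>i\<psi>(x) dx\<close> at \<open>h = 0\<close>
  avoids the symmetry of second derivatives.\<close>

lemma integral_partial_deriv_swap:
  assumes \<phi>: "\<phi> \<in> test_fun UNIV" and \<psi>: "\<psi> \<in> test_fun UNIV"
  shows "(LINT x|lborel. partial_deriv i \<phi> x * partial_deriv j \<psi> x)
       = (LINT x|lborel. partial_deriv j \<phi> x * partial_deriv i \<psi> x)"
proof -
  define h :: "nat \<Rightarrow> real" where "h n = 1 / Suc n" for n
  have h: "h \<longlonglongrightarrow> 0" "h n \<noteq> 0" for n
    using LIMSEQ_inverse_real_of_nat by (auto simp: h_def[abs_def] inverse_eq_divide)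
  let ?e = "axis j 1 :: real^2"
  have 1: "(\<lambda>n. LINT x|lborel. partial_deriv i \<phi> x * ((\<psi> (x + h n *\<^sub>R ?e) - \<psi> x) / h n))
    \<longlonglongrightarrow> (LINT x|lborel. partial_deriv i \<phi> x * partial_deriv j \<psi> x)"
    using h by (intro integral_difference_quotient_tendsto[OF \<psi>]
        test_fun_integrable[OF test_fun_partial_deriv[OF \<phi>]])
  have 2: "(\<lambda>n. LINT x|lborel. partial_deriv i \<psi> x * ((\<phi> (x + (- h n) *\<^sub>R ?e) - \<phi> x) / (- h n)))
    \<longlonglongrightarrow> (LINT x|lborel. partial_deriv i \<psi> x * partial_deriv j \<phi> x)"
    using h tendsto_minus[OF h(1)]
    by (intro integral_difference_quotient_tendsto[OF \<phi>]
        test_fun_integrable[OF test_fun_partial_deriv[OF \<psi>]]) auto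
  have "(LINT x|lborel. partial_deriv i \<phi> x * ((\<psi> (x + h n *\<^sub>R ?e) - \<psi> x) / h n))
      = (LINT x|lborel. partial_deriv i \<psi> x * ((\<phi> (x + (- h n) *\<^sub>R ?e) - \<phi> x) / (- h n)))" for n
  proof -
    let ?v = "h n *\<^sub>R ?e"
    have T: "(\<lambda>x. \<psi> (x + ?v)) \<in> test_fun UNIV" "(\<lambda>x. \<phi> (x + (- ?v))) \<in> test_fun UNIV"
      by (rule test_fun_translate \<phi> \<psi>)+
    note D = test_fun_partial_deriv[OF \<phi>] test_fun_partial_deriv[OF \<psi>]
    note I = test_fun_integrable[OF test_fun_mult[of _ UNIV _ UNIV]]
    have "(LINT x|lborel. partial_deriv i \<phi> x * \<psi> (x + ?v))
        = - (LINT x|lborel. \<phi> x * partial_deriv i (\<lambda>x. \<psi> (x + ?v)) x)"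
      using integral_by_parts_test_fun[OF \<phi> T(1), of i] by simp
    also have "\<dots> = - (LINT x|lborel. \<phi> x * partial_deriv i \<psi> (x + ?v))"
      by (simp add: partial_deriv_translate[OF test_funD(2)[OF \<psi>]])
    also have "\<dots> = - (LINT x|lborel. \<phi> (x + ?v + (- ?v)) * partial_deriv i \<psi> (x + ?v))"
      by simp
    also have "\<dots> = - (LINT x|lborel. \<phi> (x + (- ?v)) * partial_deriv i \<psi> x)"
      by (subst lborel_integral_translate[where f="\<lambda>x. \<phi> (x + (- ?v)) * partial_deriv i \<psi> x"])
         (intro test_fun_borel_measurable[OF test_fun_mult[OF T(2) D(2)]] refl)+
    finally have A: "(LINT x|lborel. partial_deriv i \<phi> x * \<psi> (x + ?v))
        = - (LINT x|lborel. \<phi> (x + (- ?v)) * partial_deriv i \<psi> x)" .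
    have B: "(LINT x|lborel. partial_deriv i \<phi> x * \<psi> x) = - (LINT x|lborel. \<phi> x * partial_deriv i \<psi> x)"
      using integral_by_parts_test_fun[OF \<phi> \<psi>, of i] by simp
    have "(LINT x|lborel. partial_deriv i \<phi> x * ((\<psi> (x + ?v) - \<psi> x) / h n))
        = ((LINT x|lborel. partial_deriv i \<phi> x * \<psi> (x + ?v))
          - (LINT x|lborel. partial_deriv i \<phi> x * \<psi> x)) / h n"
      using I[OF D(1) T(1)] I[OF D(1) \<psi>] by (simp add: right_diff_distrib)
    also have "\<dots> = ((LINT x|lborel. \<phi> (x + (- ?v)) * partial_deriv i \<psi> x)
        - (LINT x|lborel. \<phi> x * partial_deriv i \<psi> x)) / (- h n)"
      unfolding A B using h(2)[of n] by (simp add: field_simps)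
    also have "\<dots> = (LINT x|lborel. partial_deriv i \<psi> x * ((\<phi> (x + (- ?v)) - \<phi> x) / (- h n)))"
      using I[OF T(2) D(2)] I[OF \<phi> D(2)]
      by (simp add: left_diff_distrib right_diff_distrib mult.commute[of _ "partial_deriv i \<psi> _"])
         (simp add: field_simps)
    finally show ?thesis by (simp only: scaleR_minus_left)
  qed
  with 1 2 have "(LINT x|lborel. partial_deriv i \<phi> x * partial_deriv j \<psi> x)
      = (LINT x|lborel. partial_deriv i \<psi> x * partial_deriv j \<phi> x)"
    by - (rule LIMSEQ_unique[OF 1], simp)
  then show ?thesis by (simp add: mult.commute)
qed

subsection \<open>Test functions on a bounded open set\<close>

locale bounded_open_set =
  fixes \<Omega> :: "(real^2) set"
  assumes open_dom: "open \<Omega>" and bounded_dom: "bounded \<Omega>"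
begin

lemma lmeasurable_dom: "\<Omega> \<in> lmeasurable"
  by (rule lmeasurable_open[OF bounded_dom open_dom])

lemma sets_dom: "\<Omega> \<in> sets lebesgue"
  using lmeasurable_dom by blast

sublocale dom: finite_measure "lebesgue_on \<Omega>"
  by (rule finite_measure_lebesgue_on[OF lmeasurable_dom])

lemma L2_bounded:
  assumes "f \<in> borel_measurable (lebesgue_on \<Omega>)" "\<And>x. x \<in> \<Omega> \<Longrightarrow> norm (f x) \<le> B"
  shows "f \<in> L2 \<Omega>"
proof (rule L2I)
  show "integrable (lebesgue_on \<Omega>) (\<lambda>x. f x \<bullet> f x)"
  proof (rule dom.integrable_const_bound)
    show "AE x in lebesgue_on \<Omega>. norm (f x \<bullet> f x) \<le> B\<^sup>2"
      using assms(2) by (intro AE_I2) (auto simp: power_mono simp flip: power2_norm_eq_inner)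
    show "(\<lambda>x. f x \<bullet> f x) \<in> borel_measurable (lebesgue_on \<Omega>)"
      using assms(1) by simp
  qed
qed (rule assms(1))

lemma L2_const: "(\<lambda>x. c) \<in> L2 \<Omega>"
  by (rule L2_bounded[where B="norm c"]) auto

lemma borel_imp_measurable_dom: "f \<in> borel_measurable borel \<Longrightarrow> f \<in> borel_measurable (lebesgue_on \<Omega>)"
  by (intro measurable_restrict_space1 measurable_completion) simp

lemma test_fun_L2: "\<phi> \<in> test_fun \<Omega> \<Longrightarrow> \<phi> \<in> L2 \<Omega>"
  by (metis L2_bounded borel_imp_measurable_dom test_fun_borel_measurable test_fun_bounded real_norm_def)

lemma integral_dom_eq_lborel:
  fixes f :: "real^2 \<Rightarrow> real"
  assumes "f \<in> borel_measurable borel" "\<And>x. x \<notin> \<Omega> \<Longrightarrow> f x = 0"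
  shows "(LINT x|lebesgue_on \<Omega>. f x) = (LINT x|lborel. f x)"
proof -
  have "(LINT x|lebesgue_on \<Omega>. f x) = (LINT x|lebesgue. (if x \<in> \<Omega> then f x else 0))"
    by (rule Lebesgue_Measure.integral_restrict_UNIV[OF sets_dom, symmetric])
  also have "(\<lambda>x. if x \<in> \<Omega> then f x else 0) = f"
    using assms(2) by auto
  also have "integral\<^sup>L lebesgue f = integral\<^sup>L lborel f"
    using assms(1) by (intro integral_completion) simp
  finally show ?thesis .
qed

lemma test_fun_L2_inner:
  assumes "\<phi> \<in> test_fun \<Omega>" "\<psi> \<in> test_fun \<Omega>"
  shows "L2_inner \<Omega> \<phi> \<psi> = (LINT x|lborel. \<phi> x * \<psi> x)"
  unfolding L2_inner_def inner_real_def
  using test_fun_mult[OF assms]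
  by (intro integral_dom_eq_lborel test_fun_borel_measurable test_funD(6))

lemma test_fun_is_weak_partial:
  assumes "\<phi> \<in> test_fun \<Omega>"
  shows "is_weak_partial \<Omega> i \<phi> (partial_deriv i \<phi>)"
  unfolding is_weak_partial_def
  using integral_by_parts_test_fun[OF assms, of _ \<Omega> i]
  by (simp add: test_fun_L2_inner assms test_fun_partial_deriv)

lemma test_fun_partial_deriv_swap:
  assumes "\<phi> \<in> test_fun \<Omega>" "\<psi> \<in> test_fun \<Omega>"
  shows "L2_inner \<Omega> (partial_deriv i \<phi>) (partial_deriv j \<psi>)
       = L2_inner \<Omega> (partial_deriv j \<phi>) (partial_deriv i \<psi>)"
  using assms test_fun_mono[of \<Omega> UNIV] integral_partial_deriv_swap[of \<phi> \<psi> i j]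
  by (simp add: test_fun_L2_inner test_fun_partial_deriv subset_eq)

lemma test_fun_partial_deriv_mean:
  assumes "\<phi> \<in> test_fun \<Omega>"
  shows "L2_inner \<Omega> (partial_deriv i \<phi>) (\<lambda>x. 1) = 0"
proof -
  note D = test_fun_partial_deriv[OF assms, of i]
  have "L2_inner \<Omega> (partial_deriv i \<phi>) (\<lambda>x. 1) = (LINT x|lebesgue_on \<Omega>. partial_deriv i \<phi> x)"
    by (simp add: L2_inner_def)
  also have "\<dots> = (LINT x|lborel. partial_deriv i \<phi> x)"
    by (rule integral_dom_eq_lborel[OF test_fun_borel_measurable[OF D] test_funD(6)[OF D]])
  also have "\<dots> = 0" by (rule integral_partial_deriv_eq_0[OF assms])
  finally show ?thesis .
qed

text \<open>Integrate \<open>\<partial>\<^sub>i (x\<^sub>i \<phi>\<^sup>2) = \<phi>\<^sup>2 + 2 x\<^sub>i \<phi> \<partial>\<^sub>i\<phi>\<close>.\<close>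

lemma Poincare_test_fun:
  assumes \<phi>: "\<phi> \<in> test_fun \<Omega>" and R: "\<And>x. x \<in> \<Omega> \<Longrightarrow> norm x \<le> R" "R \<ge> 0"
  shows "L2_norm \<Omega> \<phi> \<le> 2 * R * L2_norm \<Omega> (partial_deriv i \<phi>)"
proof -
  define \<psi> where "\<psi> = (\<lambda>x. x $ i * \<phi> x)"
  have \<psi>: "\<psi> \<in> test_fun \<Omega>"
    unfolding \<psi>_def by (rule test_fun_mult_left[OF C_k_component \<phi>])
  note D\<phi> = test_fun_partial_deriv[OF \<phi>, of i] and D\<psi> = test_fun_partial_deriv[OF \<psi>, of i]
  have comp: "((\<lambda>x::real^2. x $ i) has_derivative (\<lambda>x. x $ i)) (at x)" for x
    by (rule bounded_linear_imp_has_derivative[OF bounded_linear_vec_nth])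
  have "partial_deriv i \<psi> x = \<phi> x + x $ i * partial_deriv i \<phi> x" for x
  proof -
    have "partial_deriv i (\<lambda>x. x $ i) x = 1"
      by (simp add: partial_deriv_eq[OF comp])
    then show ?thesis
      unfolding \<psi>_def using comp
      by (subst partial_deriv_mult) (auto intro: test_funD(2)[OF \<phi>] differentiableI)
  qed
  then have D\<psi>_eq: "partial_deriv i \<psi> = (\<lambda>x. \<phi> x + x $ i * partial_deriv i \<phi> x)" by auto
  have "L2_inner \<Omega> \<phi> (partial_deriv i \<psi>) = - L2_inner \<Omega> (partial_deriv i \<phi>) \<psi>"
    using test_fun_is_weak_partial[OF \<phi>, of i] \<psi> by (simp add: is_weak_partial_def)
  moreover have "L2_inner \<Omega> \<phi> (partial_deriv i \<psi>)
      = L2_inner \<Omega> \<phi> \<phi> + L2_inner \<Omega> \<phi> (\<lambda>x. x $ i * partial_deriv i \<phi> x)"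
    unfolding D\<psi>_eq
    by (rule L2_inner_add_right) (intro test_fun_L2 \<phi> test_fun_mult_left C_k_component D\<phi>)+
  moreover have "L2_inner \<Omega> \<phi> (\<lambda>x. x $ i * partial_deriv i \<phi> x) = L2_inner \<Omega> (partial_deriv i \<phi>) \<psi>"
    by (simp add: L2_inner_def \<psi>_def mult_ac)
  \<comment> \<open>The same inner product arises once from the product rule and once from
    integration by parts; hence the factor 2.\<close>
  ultimately have "(L2_norm \<Omega> \<phi>)\<^sup>2 = - 2 * L2_inner \<Omega> (partial_deriv i \<phi>) \<psi>"
    by (simp add: L2_norm_power2)
  also have "\<dots> \<le> 2 * (L2_norm \<Omega> (partial_deriv i \<phi>) * L2_norm \<Omega> \<psi>)"
    using L2_Cauchy_Schwarz[OF test_fun_L2[OF D\<phi>] test_fun_L2[OF \<psi>]] by linarith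
  also have "L2_norm \<Omega> \<psi> \<le> R * L2_norm \<Omega> \<phi>"
  proof (rule power2_le_imp_le)
    have "(L2_norm \<Omega> \<psi>)\<^sup>2 \<le> L2_inner \<Omega> (\<lambda>x. R * \<phi> x) (\<lambda>x. R * \<phi> x)"
      unfolding L2_norm_power2 unfolding L2_inner_def
    proof (rule integral_mono)
      show "integrable (lebesgue_on \<Omega>) (\<lambda>x. \<psi> x \<bullet> \<psi> x)"
        "integrable (lebesgue_on \<Omega>) (\<lambda>x. (R * \<phi> x) \<bullet> (R * \<phi> x))"
        by (intro L2_integrable_inner test_fun_L2 \<psi> test_fun_cmult \<phi>)+
      fix x assume "x \<in> space (lebesgue_on \<Omega>)"
      then have "\<bar>x $ i\<bar> \<le> R" using R(1)[of x] component_le_norm_cart[of x i] by simp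
      then have "\<bar>\<psi> x\<bar> \<le> \<bar>R * \<phi> x\<bar>"
        unfolding \<psi>_def abs_mult by (intro mult_right_mono) auto
      then show "\<psi> x \<bullet> \<psi> x \<le> (R * \<phi> x) \<bullet> (R * \<phi> x)"
        by (simp only: inner_real_def abs_le_square_iff flip: power2_eq_square)
    qed
    also have "\<dots> = (R * L2_norm \<Omega> \<phi>)\<^sup>2"
      by (simp add: L2_inner_cmult_left L2_inner_cmult_right power_mult_distrib L2_norm_power2)
        (simp add: power2_eq_square)
    finally show "(L2_norm \<Omega> \<psi>)\<^sup>2 \<le> (R * L2_norm \<Omega> \<phi>)\<^sup>2" .
  qed (use R in \<open>simp add: L2_norm_nonneg\<close>)
  finally have "(L2_norm \<Omega> \<phi>)\<^sup>2 \<le> 2 * (L2_norm \<Omega> (partial_deriv i \<phi>) * (R * L2_norm \<Omega> \<phi>))"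
    by (simp add: mult_left_mono L2_norm_nonneg)
  then have "L2_norm \<Omega> \<phi> * L2_norm \<Omega> \<phi> \<le> (2 * R * L2_norm \<Omega> (partial_deriv i \<phi>)) * L2_norm \<Omega> \<phi>"
    by (simp add: power2_eq_square mult_ac)
  then show ?thesis
    using R(2) L2_norm_nonneg[of \<Omega> \<phi>] L2_norm_nonneg[of \<Omega> "partial_deriv i \<phi>"]
    by (cases "L2_norm \<Omega> \<phi> = 0") (auto simp: mult_le_cancel_right)
qed

section \<open>The fundamental lemma of the calculus of variations\<close>

lemma box_integral_eq_0:
  assumes h: "h \<in> L2 \<Omega>" "\<And>\<phi>. \<phi> \<in> test_fun \<Omega> \<Longrightarrow> L2_inner \<Omega> h \<phi> = 0" and ab: "box a b \<subseteq> \<Omega>"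
  shows "(LINT x|lebesgue_on \<Omega>. indicator (box a b) x * h x) = 0"
proof -
  have h_int: "integrable (lebesgue_on \<Omega>) h"
    using L2_integrable_inner[OF h(1) L2_const[of 1]] by simp
  note [measurable] = L2_measurable[OF h(1)]
    borel_imp_measurable_dom[OF test_fun_borel_measurable[OF box_bump_test_fun[OF ab]]]
  have [measurable]: "(indicator (box a b) :: _ \<Rightarrow> real) \<in> borel_measurable (lebesgue_on \<Omega>)"
    by (rule borel_imp_measurable_dom) simp
  have "(\<lambda>n. LINT x|lebesgue_on \<Omega>. box_bump a b n x * h x)
      \<longlonglongrightarrow> (LINT x|lebesgue_on \<Omega>. indicator (box a b) x * h x)"
  proof (rule integral_dominated_convergence)
    show "integrable (lebesgue_on \<Omega>) (\<lambda>x. \<bar>h x\<bar>)" using h_int by simp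
    show "AE x in lebesgue_on \<Omega>. (\<lambda>n. box_bump a b n x * h x) \<longlonglongrightarrow> indicator (box a b) x * h x"
      by (intro AE_I2 tendsto_mult_right box_bump_limit)
    show "AE x in lebesgue_on \<Omega>. norm (box_bump a b n x * h x) \<le> \<bar>h x\<bar>" for n
      using box_bump_bounds[of a b n] by (intro AE_I2) (simp add: abs_mult mult_left_le_one_le)
  qed measurable
  moreover have "(LINT x|lebesgue_on \<Omega>. box_bump a b n x * h x) = 0" for n
    using h(2)[OF box_bump_test_fun[OF ab, of n]] by (simp add: L2_inner_def mult.commute)
  ultimately show ?thesis by (simp add: LIMSEQ_const_iff)
qed

text \<open>Within one open box contained in \<Omega>, the Borel sets over which h integrates to
  zero include all boxes and are stable under complements and countable disjoint unions. Boxes are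
  stable under intersection and generate the Borel sets, so h vanishes almost everywhere in the box;
  countably many such boxes cover \<Omega>.\<close>

lemma test_fun_orthogonal_imp_ae_0:
  assumes h: "h \<in> L2 \<Omega>" "\<And>\<phi>. \<phi> \<in> test_fun \<Omega> \<Longrightarrow> L2_inner \<Omega> h \<phi> = 0"
  shows "ae_eq \<Omega> h (\<lambda>x. 0)"
proof -
  let ?M = "lebesgue_on \<Omega>"
  have h_int: "integrable ?M h"
    using L2_integrable_inner[OF h(1) L2_const[of 1]] by simp
  have borel_dom: "A \<inter> \<Omega> \<in> sets ?M" if "A \<in> sets borel" for A
    using that by (auto simp: sets_restrict_space intro!: image_eqI[of _ _ A])
  have box_0: "AE x in ?M. x \<in> box a b \<longrightarrow> h x = 0" if ab: "box a b \<subseteq> \<Omega>" for a b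
  proof -
    \<comment> \<open>After cutting h down to one box, any other box meets the support in a box
      contained in \<Omega>, and the integral over the whole space is zero, as the step to
      complements demands.\<close>
    define g where "g = (\<lambda>x. indicator (box a b) x * h x)"
    have ind_int: "integrable ?M (\<lambda>x. indicator A x * h x)" if "A \<in> sets borel" for A
    proof -
      have "integrable ?M (\<lambda>x. indicator (A \<inter> \<Omega>) x *\<^sub>R h x)"
        by (rule integrable_mult_indicator[OF borel_dom[OF that] h_int])
      then show ?thesis
        by (rule Bochner_Integration.integrable_cong[THEN iffD1, rotated -1])
           (auto simp: indicator_def)
    qed
    have g_int: "integrable ?M g"
      unfolding g_def by (rule ind_int) simp
    have g_ind_int: "integrable ?M (\<lambda>x. indicator A x * g x)" if "A \<in> sets borel" for A
      using ind_int[of "A \<inter> box a b"] that by (simp add: g_def indicator_inter_arith mult.assoc)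
    have g_borel: "(LINT x|?M. indicator A x * g x) = 0" if "A \<in> sets borel" for A
    proof -
      have "Int_stable (range (\<lambda>(a, b). box a b :: (real^2) set))"
        by (auto simp: Int_stable_def box_Int_box)
      moreover have "range (\<lambda>(a, b). box a b :: (real^2) set) \<subseteq> Pow UNIV" by simp
      moreover have "A \<in> sigma_sets UNIV (range (\<lambda>(a, b). box a b))"
        using that by (simp add: borel_eq_box)
      ultimately show ?thesis
      proof (induction rule: sigma_sets_induct_disjoint)
        case (basic A)
        then obtain c d where "A \<inter> box a b = box c d"
          by (auto simp: box_Int_box)
        moreover have "(\<lambda>x. indicator A x * g x) = (\<lambda>x. indicator (A \<inter> box a b) x * h x)"
          by (simp add: g_def indicator_inter_arith mult.assoc)
        ultimately show ?case
          using box_integral_eq_0[OF h, of c d] ab by auto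
      next
        case empty
        then show ?case by simp
      next
        case (compl A)
        then have A: "A \<in> sets borel" by (simp add: borel_eq_box)
        have "(LINT x|?M. g x) = 0"
          unfolding g_def by (rule box_integral_eq_0[OF h ab])
        moreover have "(\<lambda>x. indicator (UNIV - A) x * g x) = (\<lambda>x. g x - indicator A x * g x)"
          by (auto simp: indicator_def)
        ultimately show ?case
          using compl g_int g_ind_int[OF A] by simp
      next
        case (union A)
        then have A: "A i \<in> sets borel" for i by (auto simp: borel_eq_box)
        have "(\<lambda>n. LINT x|?M. indicator (\<Union>i<n. A i) x * g x) \<longlonglongrightarrow> (LINT x|?M. indicator (\<Union>i. A i) x * g x)"
        proof (rule integral_dominated_convergence)
          show "integrable ?M (\<lambda>x. \<bar>g x\<bar>)" using g_int by simp
          show "AE x in ?M. (\<lambda>n. indicator (\<Union>i<n. A i) x * g x) \<longlonglongrightarrow> indicator (\<Union>i. A i) x * g x"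
            by (intro AE_I2 tendsto_mult_right LIMSEQ_indicator_UN)
          show "AE x in ?M. norm (indicator (\<Union>i<n. A i) x * g x) \<le> \<bar>g x\<bar>" for n
            by (intro AE_I2) (simp add: indicator_def)
          show "(\<lambda>x. indicator (\<Union>i. A i) x * g x) \<in> borel_measurable ?M"
            by (rule borel_measurable_integrable[OF g_ind_int]) (use A in auto)
          show "(\<lambda>x. indicator (\<Union>i<n. A i) x * g x) \<in> borel_measurable ?M" for n
            by (rule borel_measurable_integrable[OF g_ind_int]) (use A in auto)
        qed
        moreover have "(LINT x|?M. indicator (\<Union>i<n. A i) x * g x) = 0" for n
        proof -
          have "(\<lambda>x. indicator (\<Union>i<n. A i) x * g x) = (\<lambda>x. \<Sum>i<n. indicator (A i) x * g x)"
            using union by (subst indicator_UN_disjoint)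
              (auto simp: sum_distrib_right disjoint_family_on_def)
          then have "(LINT x|?M. indicator (\<Union>i<n. A i) x * g x)
              = (LINT x|?M. (\<Sum>i<n. indicator (A i) x * g x))"
            by (simp only:)
          also have "\<dots> = (\<Sum>i<n. LINT x|?M. indicator (A i) x * g x)"
            by (intro Bochner_Integration.integral_sum g_ind_int A)
          finally show ?thesis using union by simp
        qed
        ultimately show ?case by (simp add: LIMSEQ_const_iff)
      qed
    qed
    have "AE x in ?M. g x = 0"
    proof (rule dom.density_zero[OF g_int])
      fix A assume "A \<in> sets ?M"
      then obtain S where S: "S \<in> sets lebesgue" "A = \<Omega> \<inter> S"
        by (auto simp: sets_restrict_space)
      \<comment> \<open>A Lebesgue set is a Borel set up to a null set, which reduces the claim to
        \<open>g_borel\<close>.\<close>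
      obtain B N N' where B: "S = B \<union> N" "N \<subseteq> N'" "N' \<in> null_sets lborel" "B \<in> sets lborel"
        using sets_completionE[OF S(1)] .
      have "AE x in lebesgue. x \<notin> N'"
        using B(3) by (intro AE_completion AE_not_in)
      then have "AE x in ?M. x \<notin> N'"
        using sets_dom by (auto simp: AE_restrict_space_iff)
      then have "AE x in ?M. indicator A x *\<^sub>R g x = indicator B x * g x"
        using AE_space by eventually_elim (use B(1,2) S(2) in \<open>auto simp: indicator_def\<close>)
      then have "(LINT x|?M. indicator A x *\<^sub>R g x) = (LINT x|?M. indicator B x * g x)"
        using \<open>A \<in> sets ?M\<close> borel_measurable_integrable[OF g_int]
          borel_measurable_integrable[OF g_ind_int[of B]] B(4)
        by (intro integral_cong_AE) auto
      also have "\<dots> = 0" using B(4) by (intro g_borel) simp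
      finally show "set_lebesgue_integral ?M A g = 0" by (simp add: set_lebesgue_integral_def)
    qed
    then show ?thesis by eventually_elim (auto simp: g_def indicator_def)
  qed
  obtain \<D> where \<D>: "countable \<D>" "\<D> \<subseteq> Pow \<Omega>" "\<And>X. X \<in> \<D> \<Longrightarrow> \<exists>a b. X = box a b" "\<Union>\<D> = \<Omega>"
    using open_countable_Union_open_box[OF open_dom] by metis
  have "AE x in ?M. \<forall>X\<in>\<D>. x \<in> X \<longrightarrow> h x = 0"
    using \<D>(1,2,3) box_0 by (subst AE_ball_countable) (auto, fastforce)
  then show ?thesis
    unfolding ae_eq_def using AE_space by eventually_elim (use \<D>(4) in auto)
qed

subsection \<open>Completeness and projection\<close>

text \<open>The Riesz-Fischer theorem. A subsequence with geometrically small increments converges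
  absolutely almost everywhere, and Fatou's lemma shows that its pointwise limit is the L^2 limit of
  the whole sequence.\<close>

lemma L2_complete:
  fixes F :: "nat \<Rightarrow> real^2 \<Rightarrow> 'a::euclidean_space"
  assumes "L2_Cauchy \<Omega> F"
  obtains f where "L2_lim \<Omega> F f"
proof -
  let ?M = "lebesgue_on \<Omega>"
  have F: "F n \<in> L2 \<Omega>" for n using assms by (simp add: L2_Cauchy_def)
  note [measurable] = L2_measurable[OF F]
  have "\<exists>N. \<forall>m\<ge>N. \<forall>n\<ge>N. L2_norm \<Omega> (\<lambda>x. F m x - F n x) < (1/2)^k" for k
    using assms unfolding L2_Cauchy_def by simp
  then obtain N where N: "\<And>k m n. \<lbrakk>m \<ge> N k; n \<ge> N k\<rbrakk> \<Longrightarrow> L2_norm \<Omega> (\<lambda>x. F m x - F n x) < (1/2)^k"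
    by metis
  \<comment> \<open>Summing the thresholds gives an index beyond all \<open>N j\<close> with j \<le>
    k, so that \<open>r k\<close> and \<open>r (Suc k)\<close> both lie past
    \<open>N k\<close>.\<close>
  define r where "r k = (\<Sum>j\<le>k. N j)" for k
  have rN: "r k \<ge> N j" if "j \<le> k" for j k
    unfolding r_def using that by (intro member_le_sum) auto
  define d where "d k x = norm (F (r (Suc k)) x - F (r k) x)" for k x
  have [measurable]: "d k \<in> borel_measurable ?M" for k
    unfolding d_def by measurable
  have d_nonneg: "0 \<le> d k x" for k x by (simp add: d_def)
  have d_L2: "d k \<in> L2 \<Omega>" for k
  proof (rule L2I)
    have "(\<lambda>x. F (r (Suc k)) x - F (r k) x) \<in> L2 \<Omega>" by (intro L2_diff F)
    then show "integrable ?M (\<lambda>x. d k x \<bullet> d k x)"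
      by (simp add: L2_def d_def power2_eq_square)
  qed measurable
  have d_norm: "L2_norm \<Omega> (d k) \<le> (1/2)^k" for k
  proof -
    have "L2_norm \<Omega> (d k) = L2_norm \<Omega> (\<lambda>x. F (r (Suc k)) x - F (r k) x)"
      by (simp add: L2_norm_def L2_inner_def d_def dot_square_norm flip: power2_eq_square)
    then show ?thesis using N[of k "r (Suc k)" "r k"] rN[of k] by simp
  qed
  \<comment> \<open>This is the square root of the measure of \<Omega>. The Cauchy-Schwarz
    inequality against the constant 1 turns the L^2 bounds on the increments into summable L^1
    bounds.\<close>
  define c where "c = L2_norm \<Omega> (\<lambda>x. 1::real)"
  have d_int: "integrable ?M (d k)" "(LINT x|?M. d k x) \<le> (1/2)^k * c" for k
  proof -
    show "integrable ?M (d k)"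
      using L2_integrable_inner[OF d_L2 L2_const[of 1]] by simp
    have "(LINT x|?M. d k x) = L2_inner \<Omega> (d k) (\<lambda>x. 1)" by (simp add: L2_inner_def)
    also have "\<dots> \<le> L2_norm \<Omega> (d k) * c"
      unfolding c_def using L2_Cauchy_Schwarz[OF d_L2 L2_const[of 1], of k] by simp
    also have "\<dots> \<le> (1/2)^k * c"
      by (intro mult_right_mono d_norm) (simp add: c_def L2_norm_nonneg)
    finally show "(LINT x|?M. d k x) \<le> (1/2)^k * c" .
  qed
  have "(\<integral>\<^sup>+x. (\<Sum>k. ennreal (d k x)) \<partial>?M) = (\<Sum>k. \<integral>\<^sup>+x. ennreal (d k x) \<partial>?M)"
    by (rule nn_integral_suminf) measurable
  also have "\<dots> = (\<Sum>k. ennreal (LINT x|?M. d k x))"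
    by (simp add: nn_integral_eq_integral d_int d_nonneg)
  also have "\<dots> \<le> (\<Sum>k. ennreal ((1/2)^k * c))"
    by (intro suminf_le summableI ennreal_leI d_int)
  also have "\<dots> = ennreal (\<Sum>k. (1/2)^k * c)"
    by (rule suminf_ennreal2) (auto simp: c_def L2_norm_nonneg intro!: summable_mult2 summable_geometric)
  finally have "(\<integral>\<^sup>+x. (\<Sum>k. ennreal (d k x)) \<partial>?M) \<noteq> \<infinity>"
    by (auto simp: top_unique)
  then have "AE x in ?M. (\<Sum>k. ennreal (d k x)) \<noteq> \<infinity>"
    by (intro nn_integral_noteq_infinite) measurable
  then have conv: "AE x in ?M. convergent (\<lambda>k. F (r k) x)"
  proof eventually_elim
    case (elim x)
    then have "summable (\<lambda>k. d k x)"
      by (intro summable_suminf_not_top d_nonneg) simp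
    then have "summable (\<lambda>k. F (r (Suc k)) x - F (r k) x)"
      unfolding d_def by (rule summable_norm_cancel)
    then have "convergent (\<lambda>n. \<Sum>k<n. F (r (Suc k)) x - F (r k) x)"
      by (simp add: summable_iff_convergent)
    then have "convergent (\<lambda>n. F (r n) x - F (r 0) x)"
      by (simp only: sum_lessThan_telescope[of "\<lambda>k. F (r k) x"])
    from convergent_add[OF this convergent_const[of "F (r 0) x"]]
    show ?case by simp
  qed
  define f where "f x = lim (\<lambda>k. F (r k) x)" for x
  have [measurable]: "f \<in> borel_measurable ?M"
    unfolding f_def by (rule borel_measurable_lim_metric) measurable
  have lim: "AE x in ?M. (\<lambda>k. F (r k) x) \<longlonglongrightarrow> f x"
    using conv by eventually_elim (simp add: f_def convergent_LIMSEQ_iff)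
  \<comment> \<open>Fatou's lemma with m fixed and k tending to infinity along the subsequence
    yields square integrability of the difference together with its bound.\<close>
  have main: "(\<lambda>x. F m x - f x) \<in> L2 \<Omega> \<and> L2_norm \<Omega> (\<lambda>x. F m x - f x) \<le> (1/2)^j" if "m \<ge> N j" for m j
  proof -
    let ?e = "((1/2)^j)\<^sup>2 :: real"
    have nn: "(\<integral>\<^sup>+x. ennreal ((norm (F m x - F (r k) x))\<^sup>2) \<partial>?M) \<le> ennreal ?e" if "k \<ge> j" for k
    proof -
      have D: "(\<lambda>x. F m x - F (r k) x) \<in> L2 \<Omega>" by (intro L2_diff F)
      have "(\<integral>\<^sup>+x. ennreal ((norm (F m x - F (r k) x))\<^sup>2) \<partial>?M)
          = ennreal (LINT x|?M. (norm (F m x - F (r k) x))\<^sup>2)"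
        using D by (intro nn_integral_eq_integral) (auto simp: L2_def)
      also have "\<dots> = ennreal ((L2_norm \<Omega> (\<lambda>x. F m x - F (r k) x))\<^sup>2)"
        by (simp only: L2_norm_power2 L2_inner_def power2_norm_eq_inner)
      also have "\<dots> \<le> ennreal ?e"
        using N[OF \<open>m \<ge> N j\<close> rN[OF that]]
        by (intro ennreal_leI power_mono) (auto simp: L2_norm_nonneg)
      finally show ?thesis .
    qed
    have "(\<integral>\<^sup>+x. ennreal ((norm (F m x - f x))\<^sup>2) \<partial>?M)
        = (\<integral>\<^sup>+x. liminf (\<lambda>k. ennreal ((norm (F m x - F (r k) x))\<^sup>2)) \<partial>?M)"
    proof (rule nn_integral_cong_AE)
      show "AE x in ?M. ennreal ((norm (F m x - f x))\<^sup>2)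
          = liminf (\<lambda>k. ennreal ((norm (F m x - F (r k) x))\<^sup>2))"
        using lim
      proof eventually_elim
        case (elim x)
        then have "(\<lambda>k. ennreal ((norm (F m x - F (r k) x))\<^sup>2)) \<longlonglongrightarrow> ennreal ((norm (F m x - f x))\<^sup>2)"
          by (intro tendsto_ennrealI tendsto_intros)
        from lim_imp_Liminf[OF _ this] show ?case by simp
      qed
    qed
    also have "\<dots> \<le> liminf (\<lambda>k. \<integral>\<^sup>+x. ennreal ((norm (F m x - F (r k) x))\<^sup>2) \<partial>?M)"
      by (rule nn_integral_liminf) measurable
    also have "\<dots> \<le> ennreal ?e"
      using nn by (intro Liminf_le) (auto simp: eventually_sequentially)
    finally have le: "(\<integral>\<^sup>+x. ennreal ((norm (F m x - f x))\<^sup>2) \<partial>?M) \<le> ennreal ?e" .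
    have int: "integrable ?M (\<lambda>x. (norm (F m x - f x))\<^sup>2)"
      by (rule integrableI_nonneg) (use le in \<open>auto simp: top_unique less_top[symmetric]\<close>)
    then have "ennreal (LINT x|?M. (norm (F m x - f x))\<^sup>2) \<le> ennreal ?e"
      using le by (simp add: nn_integral_eq_integral)
    then have "(L2_norm \<Omega> (\<lambda>x. F m x - f x))\<^sup>2 \<le> ?e"
      by (simp only: L2_norm_power2 L2_inner_def flip: power2_norm_eq_inner) (simp add: ennreal_le_iff)
    then have "L2_norm \<Omega> (\<lambda>x. F m x - f x) \<le> (1/2)^j"
      by (rule power2_le_imp_le) simp
    with int show ?thesis by (simp add: L2_def)
  qed
  have "(\<lambda>x. F (N 0) x - (F (N 0) x - f x)) \<in> L2 \<Omega>"
    by (rule L2_diff[OF F conjunct1[OF main[OF order_refl]]])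
  then have f_L2: "f \<in> L2 \<Omega>" by simp
  have "(\<lambda>n. L2_norm \<Omega> (\<lambda>x. F n x - f x)) \<longlonglongrightarrow> 0"
  proof (rule LIMSEQ_I)
    fix e :: real assume "e > 0"
    then obtain j where "(1/2)^j < e" using real_arch_pow_inv[of e "1/2"] by auto
    then show "\<exists>no. \<forall>n\<ge>no. norm (L2_norm \<Omega> (\<lambda>x. F n x - f x) - 0) < e"
      using main[of j] by (intro exI[of _ "N j"]) (force simp: L2_norm_nonneg)
  qed
  with that[of f] F f_L2 show thesis by (simp add: L2_lim_def)
qed

end

lemma L2_lim_norm:
  assumes "L2_lim \<Omega> F f"
  shows "(\<lambda>n. L2_norm \<Omega> (F n)) \<longlonglongrightarrow> L2_norm \<Omega> f"
  unfolding L2_norm_def by (intro tendsto_real_sqrt L2_lim_inner assms)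

lemma L2_lim_imp_Cauchy:
  assumes "L2_lim \<Omega> F f"
  shows "L2_Cauchy \<Omega> F"
  unfolding L2_Cauchy_def
proof (intro conjI allI impI)
  have F: "F n \<in> L2 \<Omega>" "(\<lambda>x. F n x - f x) \<in> L2 \<Omega>" for n
    using assms by (auto simp: L2_lim_def L2_diff)
  show "F n \<in> L2 \<Omega>" for n by (rule F)
  fix e :: real assume "e > 0"
  then obtain N where N: "\<And>n. n \<ge> N \<Longrightarrow> L2_norm \<Omega> (\<lambda>x. F n x - f x) < e / 2"
    using assms LIMSEQ_D[of "\<lambda>n. L2_norm \<Omega> (\<lambda>x. F n x - f x)" 0 "e / 2"]
    by (auto simp: L2_lim_def L2_norm_nonneg)
  show "\<exists>N. \<forall>m\<ge>N. \<forall>n\<ge>N. L2_norm \<Omega> (\<lambda>x. F m x - F n x) < e"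
  proof (intro exI allI impI)
    fix m n assume "m \<ge> N" "n \<ge> N"
    then show "L2_norm \<Omega> (\<lambda>x. F m x - F n x) < e"
      using L2_norm_triangle_diff[OF F(2)[of m] F(2)[of n]] N[of m] N[of n] by simp
  qed
qed

lemma quadratic_dominates_linear_imp_0:
  fixes B C :: real
  assumes "\<And>t. 2 * t * B \<le> t\<^sup>2 * C" "C \<ge> 0"
  shows "B = 0"
proof (rule ccontr)
  assume "B \<noteq> 0"
  \<comment> \<open>The choice t = B / (C + 1), multiplied by (C + 1)^2, gives 2 (C + 1) B^2 \<le> C
    B^2. The added 1 keeps the quotient meaningful for C = 0.\<close>
  have "2 * (B / (C + 1)) * B * (C + 1)\<^sup>2 \<le> (B / (C + 1))\<^sup>2 * C * (C + 1)\<^sup>2"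
    by (intro mult_right_mono assms) simp
  also have "2 * (B / (C + 1)) * B * (C + 1)\<^sup>2 = B\<^sup>2 * (2 * (C + 1))"
    using assms(2) by (simp add: power2_eq_square field_simps)
  also have "(B / (C + 1))\<^sup>2 * C * (C + 1)\<^sup>2 = B\<^sup>2 * C"
    using assms(2) by (simp add: power_divide)
  finally show False
    using \<open>B \<noteq> 0\<close> assms(2) by (simp add: mult_le_cancel_left zero_less_power2)
qed

lemma weak_partial_H1:
  assumes "v \<in> H1 \<Omega>"
  shows "weak_partial \<Omega> i v \<in> L2 \<Omega>" "is_weak_partial \<Omega> i v (weak_partial \<Omega> i v)"
proof -
  have "\<exists>g. g \<in> L2 \<Omega> \<and> is_weak_partial \<Omega> i v g"
    using assms by (auto simp: H1_def)
  from someI_ex[OF this] show "weak_partial \<Omega> i v \<in> L2 \<Omega>" "is_weak_partial \<Omega> i v (weak_partial \<Omega> i v)"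
    by (auto simp: weak_partial_def)
qed

subsection \<open>The space \<open>H\<^sup>1\<^sub>0\<close>\<close>

definition test_grad :: "(real^2 \<Rightarrow> real) \<Rightarrow> real^2 \<Rightarrow> real^2" where
  "test_grad \<phi> x = (\<chi> i. partial_deriv i \<phi> x)"

text \<open>The closure of the graph of the gradient on test functions. In contrast to
  \<open>weak_partial\<close>, this relation is compatible with differences exactly and not merely
  almost everywhere.\<close>

definition H10_grad :: "(real^2) set \<Rightarrow> (real^2 \<Rightarrow> real) \<Rightarrow> (real^2 \<Rightarrow> real^2) \<Rightarrow> bool" where
  "H10_grad \<Omega> v g \<longleftrightarrow> (\<exists>\<phi>. (\<forall>n. \<phi> n \<in> test_fun \<Omega>) \<and> L2_lim \<Omega> \<phi> v \<and> L2_lim \<Omega> (\<lambda>n. test_grad (\<phi> n)) g)"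

lemma partial_deriv_diff_test_fun:
  assumes "\<phi> \<in> test_fun \<Omega>" "\<psi> \<in> test_fun \<Omega>"
  shows "partial_deriv i (\<lambda>x. \<phi> x - \<psi> x) x = partial_deriv i \<phi> x - partial_deriv i \<psi> x"
  using partial_deriv_eq[OF has_derivative_diff[OF
      test_funD(2)[OF assms(1), unfolded frechet_derivative_works]
      test_funD(2)[OF assms(2), unfolded frechet_derivative_works]]]
  by (simp add: partial_deriv_def)

lemma test_fun_diff: "\<lbrakk>\<phi> \<in> test_fun \<Omega>; \<psi> \<in> test_fun \<Omega>\<rbrakk> \<Longrightarrow> (\<lambda>x. \<phi> x - \<psi> x) \<in> test_fun \<Omega>"
  using test_fun_add[OF _ test_fun_cmult[of \<psi> \<Omega> "-1"], of \<phi>] by simp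

lemma test_grad_diff:
  assumes "\<phi> \<in> test_fun \<Omega>" "\<psi> \<in> test_fun \<Omega>"
  shows "test_grad (\<lambda>x. \<phi> x - \<psi> x) = (\<lambda>x. test_grad \<phi> x - test_grad \<psi> x)"
  by (rule ext) (simp add: test_grad_def vec_eq_iff partial_deriv_diff_test_fun[OF assms])

lemma test_grad_add:
  assumes "\<phi> \<in> test_fun \<Omega>" "\<psi> \<in> test_fun \<Omega>"
  shows "test_grad (\<lambda>x. \<phi> x + \<psi> x) = (\<lambda>x. test_grad \<phi> x + test_grad \<psi> x)"
  by (rule ext) (simp add: test_grad_def vec_eq_iff partial_deriv_add test_funD(2)[OF assms(1)]
      test_funD(2)[OF assms(2)])

lemma test_grad_cmult:
  assumes "\<phi> \<in> test_fun \<Omega>"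
  shows "test_grad (\<lambda>x. c * \<phi> x) = (\<lambda>x. c *\<^sub>R test_grad \<phi> x)"
proof (rule ext)
  fix x
  have "partial_deriv i (\<lambda>x. c * \<phi> x) x = c * partial_deriv i \<phi> x" for i
    by (subst partial_deriv_mult) (auto simp: test_funD(2)[OF assms] partial_deriv_def)
  then show "test_grad (\<lambda>x. c * \<phi> x) x = c *\<^sub>R test_grad \<phi> x"
    by (simp add: test_grad_def vec_eq_iff)
qed

lemma H10_grad_L2: "H10_grad \<Omega> v g \<Longrightarrow> v \<in> L2 \<Omega>" "H10_grad \<Omega> v g \<Longrightarrow> g \<in> L2 \<Omega>"
  by (auto simp: H10_grad_def L2_lim_def)

lemma H10_grad_diff:
  assumes "H10_grad \<Omega> v g" "H10_grad \<Omega> w k"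
  shows "H10_grad \<Omega> (\<lambda>x. v x - w x) (\<lambda>x. g x - k x)"
proof -
  obtain \<phi> \<psi> where *: "\<And>n. \<phi> n \<in> test_fun \<Omega>" "L2_lim \<Omega> \<phi> v" "L2_lim \<Omega> (\<lambda>n. test_grad (\<phi> n)) g"
    "\<And>n. \<psi> n \<in> test_fun \<Omega>" "L2_lim \<Omega> \<psi> w" "L2_lim \<Omega> (\<lambda>n. test_grad (\<psi> n)) k"
    using assms unfolding H10_grad_def by metis
  have "test_grad (\<lambda>x. \<phi> n x - \<psi> n x) = (\<lambda>x. test_grad (\<phi> n) x - test_grad (\<psi> n) x)" for n
    by (rule test_grad_diff[OF *(1,4)])
  then show ?thesis
    unfolding H10_grad_def using * L2_lim_diff[OF *(2,5)] L2_lim_diff[OF *(3,6)]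
    by (intro exI[of _ "\<lambda>n x. \<phi> n x - \<psi> n x"]) (simp add: test_fun_diff)
qed

section \<open>Orthogonal projection, gradients in H^1_0 and the Dirichlet problem\<close>

context bounded_open_set
begin

lemma test_grad_L2: "\<phi> \<in> test_fun \<Omega> \<Longrightarrow> test_grad \<phi> \<in> L2 \<Omega>"
  unfolding test_grad_def[abs_def] by (intro L2_vec_lambda test_fun_L2 test_fun_partial_deriv)

text \<open>G is a subspace that need not be closed, so the projection is only a limit of members of
  G. The minimizing sequence is returned as well, because for gradients its terms supply the
  approximating test functions.\<close>

lemma L2_projection:
  fixes G :: "(real^2 \<Rightarrow> 'a::euclidean_space) set"
  assumes F: "F \<in> L2 \<Omega>" and G: "G \<subseteq> L2 \<Omega>" "G \<noteq> {}"
    and G_add: "\<And>g h. \<lbrakk>g \<in> G; h \<in> G\<rbrakk> \<Longrightarrow> (\<lambda>x. g x + h x) \<in> G"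
    and G_scale: "\<And>c g. g \<in> G \<Longrightarrow> (\<lambda>x. c *\<^sub>R g x) \<in> G"
  obtains \<gamma> g where "\<And>n. \<gamma> n \<in> G" "L2_lim \<Omega> \<gamma> g"
    "\<And>h. h \<in> G \<Longrightarrow> L2_inner \<Omega> g h = L2_inner \<Omega> F h"
proof -
  define q where "q h = (L2_norm \<Omega> (\<lambda>x. F x - h x))\<^sup>2" for h
  define d where "d = Inf (q ` G)"
  have bdd: "bdd_below (q ` G)"
    by (rule bdd_belowI[of _ 0]) (auto simp: q_def)
  have d_le: "d \<le> q h" if "h \<in> G" for h
    unfolding d_def by (rule cInf_lower[OF imageI[OF that] bdd])
  have "\<exists>h\<in>G. q h < d + 1 / Suc n" for n
    using cInf_lessD[of "q ` G" "d + 1 / Suc n"] G(2) unfolding d_def by auto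
  then obtain \<gamma> where \<gamma>: "\<And>n. \<gamma> n \<in> G" "\<And>n. q (\<gamma> n) < d + 1 / Suc n" by metis
  have \<gamma>_L2: "\<gamma> n \<in> L2 \<Omega>" for n using \<gamma>(1) G(1) by auto
  have q_eq: "q h = L2_inner \<Omega> F F - 2 * L2_inner \<Omega> F h + L2_inner \<Omega> h h" if "h \<in> L2 \<Omega>" for h
    using that F by (simp add: q_def L2_norm_power2 L2_inner_diff_left L2_inner_diff_right L2_diff
        L2_inner_commute[of \<Omega> h F])
  \<comment> \<open>The parallelogram law around F: the midpoint of two terms lies in G, so its
    squared distance to F is at least d, and only the excesses 1 / Suc m and 1 / Suc n
    remain.\<close>
  have par: "(L2_norm \<Omega> (\<lambda>x. \<gamma> m x - \<gamma> n x))\<^sup>2 \<le> 2 * (1 / Suc m + 1 / Suc n)" for m n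
  proof -
    define h where "h = (\<lambda>x. (1/2) *\<^sub>R (\<gamma> m x + \<gamma> n x))"
    have h: "h \<in> G" unfolding h_def by (intro G_scale G_add \<gamma>)
    have "(L2_norm \<Omega> (\<lambda>x. \<gamma> m x - \<gamma> n x))\<^sup>2 = 2 * q (\<gamma> m) + 2 * q (\<gamma> n) - 4 * q h"
      using h G(1) \<gamma>_L2 F
      by (simp add: q_eq subsetD[OF G(1)] L2_norm_power2 L2_inner_diff_left L2_inner_diff_right L2_diff
          h_def L2_inner_scaleR_left L2_inner_scaleR_right L2_inner_add_left L2_inner_add_right
          L2_add L2_scaleR L2_inner_commute[of \<Omega> "\<gamma> n" "\<gamma> m"] algebra_simps del: scaleR_add_right)
    then show ?thesis using \<gamma>(2)[of m] \<gamma>(2)[of n] d_le[OF h] by argo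
  qed
  have "L2_Cauchy \<Omega> \<gamma>"
    unfolding L2_Cauchy_def
  proof (intro conjI allI impI)
    fix e :: real assume "e > 0"
    then obtain N where N: "1 / Suc N < e\<^sup>2 / 4"
      using reals_Archimedean[of "e\<^sup>2 / 4"] by (auto simp: inverse_eq_divide)
    show "\<exists>N. \<forall>m\<ge>N. \<forall>n\<ge>N. L2_norm \<Omega> (\<lambda>x. \<gamma> m x - \<gamma> n x) < e"
    proof (intro exI allI impI)
      fix m n assume "m \<ge> N" "n \<ge> N"
      then have "1 / Suc m \<le> 1 / Suc N" "1 / Suc n \<le> 1 / Suc N"
        by (auto intro!: divide_left_mono)
      with par[of m n] N have "(L2_norm \<Omega> (\<lambda>x. \<gamma> m x - \<gamma> n x))\<^sup>2 < e\<^sup>2" by argo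
      with \<open>e > 0\<close> show "L2_norm \<Omega> (\<lambda>x. \<gamma> m x - \<gamma> n x) < e"
        by (auto intro: power2_less_imp_less)
    qed
  qed (rule \<gamma>_L2)
  then obtain g where g: "L2_lim \<Omega> \<gamma> g" by (rule L2_complete)
  then have g_L2: "g \<in> L2 \<Omega>" by (simp add: L2_lim_def)
  have q_lim: "(\<lambda>n. q (\<lambda>x. \<gamma> n x + h x)) \<longlonglongrightarrow> q (\<lambda>x. g x + h x)" if "h \<in> L2 \<Omega>" for h
    unfolding q_def
    by (intro tendsto_power L2_lim_norm L2_lim_diff L2_lim_const L2_lim_add F g that)
  have "(\<lambda>n. d + 1 / Suc n) \<longlonglongrightarrow> d + 0"
    using LIMSEQ_inverse_real_of_nat by (intro tendsto_add tendsto_const) (simp add: inverse_eq_divide)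
  moreover have "(\<lambda>n. q (\<gamma> n)) \<longlonglongrightarrow> q g"
    using q_lim[OF L2_zero] by simp
  ultimately have "q g \<le> d"
    using \<gamma>(2) by (intro LIMSEQ_le[of "\<lambda>n. q (\<gamma> n)" _ "\<lambda>n. d + 1 / Suc n"]) (auto intro: less_imp_le)
  have orth: "L2_inner \<Omega> g h = L2_inner \<Omega> F h" if h: "h \<in> G" for h
  proof -
    have h_L2: "h \<in> L2 \<Omega>" using h G(1) by auto
    have "L2_inner \<Omega> (\<lambda>x. F x - g x) h = 0"
    proof (rule quadratic_dominates_linear_imp_0)
      fix t
      \<comment> \<open>As g may lie outside G, minimality along this line is inherited from the
        perturbed terms of the minimizing sequence.\<close>
      have "d \<le> q (\<lambda>x. g x + t *\<^sub>R h x)"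
        using d_le[OF G_add[OF \<gamma>(1) G_scale[OF h]]]
        by (intro LIMSEQ_le_const[OF q_lim[OF L2_scaleR[OF h_L2]]]) auto
      also have "\<dots> = q g - 2 * t * L2_inner \<Omega> (\<lambda>x. F x - g x) h + t\<^sup>2 * L2_inner \<Omega> h h"
        using g_L2 h_L2 F
        by (simp add: q_eq L2_add L2_scaleR L2_inner_add_left L2_inner_add_right L2_inner_scaleR_left
            L2_inner_scaleR_right L2_inner_diff_left L2_inner_commute[of \<Omega> h g]
            power2_eq_square algebra_simps)
      finally show "2 * t * L2_inner \<Omega> (\<lambda>x. F x - g x) h \<le> t\<^sup>2 * L2_inner \<Omega> h h"
        using \<open>q g \<le> d\<close> by linarith
    qed (rule L2_inner_self_nonneg)
    then show ?thesis using F g_L2 h_L2 by (simp add: L2_inner_diff_left)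
  qed
  show thesis by (rule that[OF \<gamma>(1) g orth])
qed

lemma is_weak_partial_unique:
  assumes "is_weak_partial \<Omega> i v g" "is_weak_partial \<Omega> i v g'" "g \<in> L2 \<Omega>" "g' \<in> L2 \<Omega>"
  shows "ae_eq \<Omega> g g'"
proof -
  have "ae_eq \<Omega> (\<lambda>x. g x - g' x) (\<lambda>x. 0)"
    using assms by (intro test_fun_orthogonal_imp_ae_0)
      (auto simp: L2_diff L2_inner_diff_left test_fun_L2 is_weak_partial_def)
  then show ?thesis by (simp add: ae_eq_def)
qed

lemma weak_partial_ae_eq:
  assumes "is_weak_partial \<Omega> i v g" "g \<in> L2 \<Omega>"
  shows "weak_partial \<Omega> i v \<in> L2 \<Omega>" "ae_eq \<Omega> (weak_partial \<Omega> i v) g"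
proof -
  have "weak_partial \<Omega> i v \<in> L2 \<Omega> \<and> is_weak_partial \<Omega> i v (weak_partial \<Omega> i v)"
    unfolding weak_partial_def by (rule someI[of _ g]) (use assms in auto)
  then show "weak_partial \<Omega> i v \<in> L2 \<Omega>" "ae_eq \<Omega> (weak_partial \<Omega> i v) g"
    using is_weak_partial_unique[OF _ assms(1) _ assms(2)] by auto
qed

text \<open>The derivative chosen for a difference is unrelated to the choices for its two terms;
  uniqueness makes them compatible almost everywhere, hence under the norm. This makes the H^1
  distance in the definition of \<open>H10\<close> computable.\<close>

lemma L2_norm_weak_partial_diff:
  assumes "\<phi> \<in> test_fun \<Omega>" "is_weak_partial \<Omega> i v g" "v \<in> L2 \<Omega>" "g \<in> L2 \<Omega>"
  shows "L2_norm \<Omega> (weak_partial \<Omega> i (\<lambda>x. \<phi> x - v x)) = L2_norm \<Omega> (\<lambda>x. partial_deriv i \<phi> x - g x)"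
proof -
  have "is_weak_partial \<Omega> i (\<lambda>x. \<phi> x - v x) (\<lambda>x. partial_deriv i \<phi> x - g x)"
    using assms test_fun_is_weak_partial[OF assms(1), of i]
    by (auto simp: is_weak_partial_def L2_inner_diff_left test_fun_L2 test_fun_partial_deriv)
  from weak_partial_ae_eq[OF this] assms show ?thesis
    by (intro L2_norm_cong) (auto simp: L2_diff test_fun_L2 test_fun_partial_deriv)
qed

lemma H10_grad_is_weak_partial:
  assumes "H10_grad \<Omega> v g"
  shows "is_weak_partial \<Omega> i v (\<lambda>x. g x $ i)"
  unfolding is_weak_partial_def
proof
  fix \<psi> assume \<psi>: "\<psi> \<in> test_fun \<Omega>"
  obtain \<phi> where \<phi>: "\<And>n. \<phi> n \<in> test_fun \<Omega>" "L2_lim \<Omega> \<phi> v" "L2_lim \<Omega> (\<lambda>n. test_grad (\<phi> n)) g"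
    using assms unfolding H10_grad_def by metis
  have "(\<lambda>n. L2_inner \<Omega> (\<phi> n) (partial_deriv i \<psi>)) \<longlonglongrightarrow> L2_inner \<Omega> v (partial_deriv i \<psi>)"
    by (intro L2_lim_inner \<phi> L2_lim_const test_fun_L2 test_fun_partial_deriv \<psi>)
  moreover have "(\<lambda>n. L2_inner \<Omega> (\<lambda>x. test_grad (\<phi> n) x $ i) \<psi>) \<longlonglongrightarrow> L2_inner \<Omega> (\<lambda>x. g x $ i) \<psi>"
    by (intro L2_lim_inner L2_lim_vec_nth \<phi> L2_lim_const test_fun_L2 \<psi>)
  moreover have "L2_inner \<Omega> (\<phi> n) (partial_deriv i \<psi>) = - L2_inner \<Omega> (\<lambda>x. test_grad (\<phi> n) x $ i) \<psi>" for n
    using test_fun_is_weak_partial[OF \<phi>(1), of i n] \<psi> by (simp add: is_weak_partial_def test_grad_def)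
  ultimately show "L2_inner \<Omega> v (partial_deriv i \<psi>) = - L2_inner \<Omega> (\<lambda>x. g x $ i) \<psi>"
    by (intro LIMSEQ_unique[OF _ tendsto_minus]) simp_all
qed

lemma H10_grad_unique:
  assumes "H10_grad \<Omega> v g" "H10_grad \<Omega> v g'"
  shows "ae_eq \<Omega> g g'"
proof -
  have "ae_eq \<Omega> (\<lambda>x. g x $ i) (\<lambda>x. g' x $ i)" for i
    by (intro is_weak_partial_unique[OF H10_grad_is_weak_partial[OF assms(1)]
          H10_grad_is_weak_partial[OF assms(2)]] L2_vec_nth H10_grad_L2(2)[OF assms(1)]
        H10_grad_L2(2)[OF assms(2)])
  then show ?thesis by (simp add: ae_eq_def vec_eq_iff AE_all_countable)
qed

text \<open>With its counterpart \<open>H10_imp_H10_grad\<close>, this lets the later arguments use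
  \<open>H10_grad\<close> in place of the H^1 norm and its chosen derivatives.\<close>

lemma H10_grad_imp_H10:
  assumes "H10_grad \<Omega> v g"
  shows "v \<in> H10 \<Omega>"
proof -
  obtain \<phi> where \<phi>: "\<And>n. \<phi> n \<in> test_fun \<Omega>" "L2_lim \<Omega> \<phi> v" "L2_lim \<Omega> (\<lambda>n. test_grad (\<phi> n)) g"
    using assms unfolding H10_grad_def by metis
  note W = H10_grad_is_weak_partial[OF assms] and L = H10_grad_L2[OF assms]
  have "(\<lambda>n. L2_norm \<Omega> (\<lambda>x. \<phi> n x - v x)) \<longlonglongrightarrow> 0"
    using \<phi>(2) by (simp add: L2_lim_def)
  moreover have "(\<lambda>n. L2_norm \<Omega> (weak_partial \<Omega> i (\<lambda>x. \<phi> n x - v x))) \<longlonglongrightarrow> 0" for i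
    using L2_lim_vec_nth[OF \<phi>(3), of i]
    by (simp add: L2_norm_weak_partial_diff[OF \<phi>(1) W L(1) L2_vec_nth[OF L(2)]] L2_lim_def test_grad_def)
  ultimately have "(\<lambda>n. H1_norm \<Omega> (\<lambda>x. \<phi> n x - v x)) \<longlonglongrightarrow> sqrt (0\<^sup>2 + (\<Sum>i\<in>(UNIV::2 set). 0\<^sup>2))"
    unfolding H1_norm_def by (intro tendsto_intros)
  moreover have "v \<in> H1 \<Omega>"
    using L W by (auto simp: H1_def intro: L2_vec_nth)
  ultimately show ?thesis using \<phi>(1) by (auto simp: H10_def)
qed

lemma H10_imp_H10_grad:
  assumes "v \<in> H10 \<Omega>"
  shows "H10_grad \<Omega> v (\<lambda>x. \<chi> i. weak_partial \<Omega> i v x)"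
proof -
  have v: "v \<in> H1 \<Omega>" "v \<in> L2 \<Omega>" using assms by (auto simp: H10_def H1_def)
  obtain \<phi> where \<phi>: "\<And>n. \<phi> n \<in> test_fun \<Omega>" "(\<lambda>n. H1_norm \<Omega> (\<lambda>x. \<phi> n x - v x)) \<longlonglongrightarrow> 0"
    using assms by (auto simp: H10_def)
  have "L2_norm \<Omega> (\<lambda>x. \<phi> n x - v x) \<le> H1_norm \<Omega> (\<lambda>x. \<phi> n x - v x)" for n
    unfolding H1_norm_def by (intro real_le_rsqrt) (simp add: sum_nonneg)
  then have "(\<lambda>n. L2_norm \<Omega> (\<lambda>x. \<phi> n x - v x)) \<longlonglongrightarrow> 0"
    by (intro tendsto_sandwich[OF _ _ tendsto_const \<phi>(2)] always_eventually) (auto simp: L2_norm_nonneg)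
  then have 1: "L2_lim \<Omega> \<phi> v"
    using v \<phi>(1) by (simp add: L2_lim_def test_fun_L2)
  have "L2_norm \<Omega> (\<lambda>x. partial_deriv i (\<phi> n) x - weak_partial \<Omega> i v x)
      \<le> H1_norm \<Omega> (\<lambda>x. \<phi> n x - v x)" for n i
  proof -
    have "L2_norm \<Omega> (\<lambda>x. partial_deriv i (\<phi> n) x - weak_partial \<Omega> i v x)
        = L2_norm \<Omega> (weak_partial \<Omega> i (\<lambda>x. \<phi> n x - v x))"
      using L2_norm_weak_partial_diff[OF \<phi>(1) weak_partial_H1(2)[OF v(1)] v(2) weak_partial_H1(1)[OF v(1)]]
      by simp
    also have "\<dots> \<le> H1_norm \<Omega> (\<lambda>x. \<phi> n x - v x)"
      unfolding H1_norm_def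
      by (intro real_le_rsqrt add_increasing member_le_sum) auto
    finally show ?thesis .
  qed
  then have "(\<lambda>n. L2_norm \<Omega> (\<lambda>x. partial_deriv i (\<phi> n) x - weak_partial \<Omega> i v x)) \<longlonglongrightarrow> 0" for i
    by (intro tendsto_sandwich[OF _ _ tendsto_const \<phi>(2)] always_eventually) (auto simp: L2_norm_nonneg)
  then have "L2_lim \<Omega> (\<lambda>n. partial_deriv i (\<phi> n)) (weak_partial \<Omega> i v)" for i
    using \<phi>(1) weak_partial_H1(1)[OF v(1)] by (simp add: L2_lim_def test_fun_L2 test_fun_partial_deriv)
  from L2_lim_vec_lambda[OF this]
  have "L2_lim \<Omega> (\<lambda>n. test_grad (\<phi> n)) (\<lambda>x. \<chi> i. weak_partial \<Omega> i v x)"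
    by (simp add: test_grad_def[abs_def])
  with 1 \<phi>(1) show ?thesis unfolding H10_grad_def by blast
qed

text \<open>Elements of H^1_0 have no second derivatives in general, so the interchange is inherited
  from test functions by passing to the limit in both arguments.\<close>

lemma H10_grad_swap:
  assumes "H10_grad \<Omega> v g" "H10_grad \<Omega> w k"
  shows "L2_inner \<Omega> (\<lambda>x. g x $ i) (\<lambda>x. k x $ j) = L2_inner \<Omega> (\<lambda>x. g x $ j) (\<lambda>x. k x $ i)"
proof -
  obtain \<phi> \<psi> where *: "\<And>n. \<phi> n \<in> test_fun \<Omega>" "L2_lim \<Omega> (\<lambda>n. test_grad (\<phi> n)) g"
    "\<And>n. \<psi> n \<in> test_fun \<Omega>" "L2_lim \<Omega> (\<lambda>n. test_grad (\<psi> n)) k"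
    using assms unfolding H10_grad_def by metis
  have "(\<lambda>n. L2_inner \<Omega> (\<lambda>x. test_grad (\<phi> n) x $ a) (\<lambda>x. test_grad (\<psi> n) x $ b))
      \<longlonglongrightarrow> L2_inner \<Omega> (\<lambda>x. g x $ a) (\<lambda>x. k x $ b)" for a b
    by (intro L2_lim_inner L2_lim_vec_nth *)
  from this[of i j] this[of j i] show ?thesis
    using test_fun_partial_deriv_swap[OF *(1) *(3), of i _ j]
    by (intro LIMSEQ_unique) (auto simp: test_grad_def)
qed

text \<open>Constants lie in L^2 of the bounded set \<Omega>, so the mean is continuous under L^2
  limits. This is what places the divergence in \<open>Q0\<close>.\<close>

lemma H10_grad_mean:
  assumes "H10_grad \<Omega> v g"
  shows "L2_inner \<Omega> (\<lambda>x. g x $ i) (\<lambda>x. 1) = 0"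
proof -
  obtain \<phi> where \<phi>: "\<And>n. \<phi> n \<in> test_fun \<Omega>" "L2_lim \<Omega> (\<lambda>n. test_grad (\<phi> n)) g"
    using assms unfolding H10_grad_def by metis
  have "(\<lambda>n. L2_inner \<Omega> (\<lambda>x. test_grad (\<phi> n) x $ i) (\<lambda>x. 1)) \<longlonglongrightarrow> L2_inner \<Omega> (\<lambda>x. g x $ i) (\<lambda>x. 1)"
    by (intro L2_lim_inner L2_lim_vec_nth \<phi> L2_lim_const L2_const)
  then show ?thesis
    using test_fun_partial_deriv_mean[OF \<phi>(1), of i] by (simp add: test_grad_def LIMSEQ_const_iff)
qed

text \<open>The constant is twice the radius of a ball about 0 containing \<Omega>. The version for
  test functions is kept beside the limit version because \<open>Dirichlet_problem\<close> applies
  it before any limit of the functions is known to exist.\<close>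

lemma Poincare:
  obtains K where "K \<ge> 0" "\<And>v g. H10_grad \<Omega> v g \<Longrightarrow> L2_norm \<Omega> v \<le> K * L2_norm \<Omega> g"
    "\<And>\<phi>. \<phi> \<in> test_fun \<Omega> \<Longrightarrow> L2_norm \<Omega> \<phi> \<le> K * L2_norm \<Omega> (test_grad \<phi>)"
proof -
  obtain R where R: "R > 0" "\<And>x. x \<in> \<Omega> \<Longrightarrow> norm x \<le> R"
    using bounded_dom unfolding bounded_pos by auto
  have test: "L2_norm \<Omega> \<phi> \<le> 2 * R * L2_norm \<Omega> (test_grad \<phi>)" if "\<phi> \<in> test_fun \<Omega>" for \<phi>
  proof -
    have "L2_norm \<Omega> \<phi> \<le> 2 * R * L2_norm \<Omega> (partial_deriv 1 \<phi>)"
      by (rule Poincare_test_fun[OF that]) (use R in auto)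
    also have "\<dots> \<le> 2 * R * L2_norm \<Omega> (test_grad \<phi>)"
      using L2_norm_vec_nth_le[OF test_grad_L2[OF that], of 1] R(1)
      by (intro mult_left_mono) (simp_all add: test_grad_def)
    finally show ?thesis .
  qed
  have "L2_norm \<Omega> v \<le> 2 * R * L2_norm \<Omega> g" if "H10_grad \<Omega> v g" for v g
  proof -
    obtain \<phi> where \<phi>: "\<And>n. \<phi> n \<in> test_fun \<Omega>" "L2_lim \<Omega> \<phi> v" "L2_lim \<Omega> (\<lambda>n. test_grad (\<phi> n)) g"
      using \<open>H10_grad \<Omega> v g\<close> unfolding H10_grad_def by metis
    show ?thesis
      using test[OF \<phi>(1)]
      by (intro LIMSEQ_le[OF L2_lim_norm[OF \<phi>(2)] tendsto_mult_left[OF L2_lim_norm[OF \<phi>(3)]]]) auto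
  qed
  with that[of "2 * R"] test R(1) show thesis by auto
qed

lemma Dirichlet_problem:
  assumes r: "r \<in> L2 \<Omega>"
  obtains v g where "H10_grad \<Omega> v g"
    "\<And>w k. H10_grad \<Omega> w k \<Longrightarrow> L2_inner \<Omega> g k = - L2_inner \<Omega> r (\<lambda>x. k x $ i)"
proof -
  define F :: "real^2 \<Rightarrow> real^2" where "F = (\<lambda>x. \<chi> j. if j = i then - r x else 0)"
  have F: "F \<in> L2 \<Omega>"
  proof -
    have "(\<lambda>x. if j = i then - r x else 0) \<in> L2 \<Omega>" for j
      using r by (cases "j = i") (simp_all add: L2_uminus L2_zero)
    then show ?thesis unfolding F_def by (rule L2_vec_lambda)
  qed
  have F_inner: "L2_inner \<Omega> F k = - L2_inner \<Omega> r (\<lambda>x. k x $ i)" for k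
  proof -
    have "F x \<bullet> k x = - (r x \<bullet> (k x $ i))" for x
      by (simp add: F_def inner_vec_def if_distrib[of "\<lambda>a. a * _"] cong: if_cong)
    then show ?thesis by (simp add: L2_inner_def)
  qed
  let ?G = "test_grad ` test_fun \<Omega>"
  have G: "?G \<subseteq> L2 \<Omega>" "?G \<noteq> {}"
    using test_fun_zero[of \<Omega>] by (auto simp: test_grad_L2)
  obtain \<gamma> g where \<gamma>: "\<And>n. \<gamma> n \<in> ?G" "L2_lim \<Omega> \<gamma> g"
    and g: "\<And>h. h \<in> ?G \<Longrightarrow> L2_inner \<Omega> g h = L2_inner \<Omega> F h"
  proof (rule L2_projection[OF F G])
    fix g h assume "g \<in> ?G" "h \<in> ?G"
    then obtain \<phi> \<psi> where *: "\<phi> \<in> test_fun \<Omega>" "g = test_grad \<phi>" "\<psi> \<in> test_fun \<Omega>" "h = test_grad \<psi>"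
      by blast
    have "(\<lambda>x. g x + h x) = test_grad (\<lambda>x. \<phi> x + \<psi> x)"
      by (simp add: *(2,4) test_grad_add[OF *(1,3)])
    then show "(\<lambda>x. g x + h x) \<in> ?G"
      using test_fun_add[OF *(1,3)] by blast
  next
    fix c g assume "g \<in> ?G"
    then obtain \<phi> where *: "\<phi> \<in> test_fun \<Omega>" "g = test_grad \<phi>"
      by blast
    have "(\<lambda>x. c *\<^sub>R g x) = test_grad (\<lambda>x. c * \<phi> x)"
      by (simp add: *(2) test_grad_cmult[OF *(1)])
    then show "(\<lambda>x. c *\<^sub>R g x) \<in> ?G"
      using test_fun_cmult[OF *(1)] by blast
  qed blast
  have "\<forall>n. \<exists>\<phi>. \<phi> \<in> test_fun \<Omega> \<and> \<gamma> n = test_grad \<phi>"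
    using \<gamma>(1) by blast
  then obtain \<phi> where "\<forall>n. \<phi> n \<in> test_fun \<Omega> \<and> \<gamma> n = test_grad (\<phi> n)"
    unfolding choice_iff by blast
  then have \<phi>: "\<And>n. \<phi> n \<in> test_fun \<Omega>" "\<gamma> = (\<lambda>n. test_grad (\<phi> n))"
    by auto
  obtain K where K: "K \<ge> 0" "\<And>\<phi>. \<phi> \<in> test_fun \<Omega> \<Longrightarrow> L2_norm \<Omega> \<phi> \<le> K * L2_norm \<Omega> (test_grad \<phi>)"
    using Poincare by metis
  \<comment> \<open>The projection makes only the gradients converge; the Poincare inequality for
    differences of the approximants transfers the Cauchy property to the functions.\<close>
  have "L2_Cauchy \<Omega> \<phi>"
    unfolding L2_Cauchy_def
  proof (intro conjI allI impI)
    fix e :: real assume "e > 0"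
    \<comment> \<open>K may be 0, so K + 1 is used as the divisor.\<close>
    then have "e / (K + 1) > 0" using K(1) by simp
    then obtain N where N: "\<And>m n. \<lbrakk>m \<ge> N; n \<ge> N\<rbrakk> \<Longrightarrow> L2_norm \<Omega> (\<lambda>x. \<gamma> m x - \<gamma> n x) < e / (K + 1)"
      using L2_lim_imp_Cauchy[OF \<gamma>(2)] unfolding L2_Cauchy_def by metis
    show "\<exists>N. \<forall>m\<ge>N. \<forall>n\<ge>N. L2_norm \<Omega> (\<lambda>x. \<phi> m x - \<phi> n x) < e"
    proof (intro exI allI impI)
      fix m n assume mn: "m \<ge> N" "n \<ge> N"
      have "L2_norm \<Omega> (\<lambda>x. \<phi> m x - \<phi> n x) \<le> K * L2_norm \<Omega> (\<lambda>x. \<gamma> m x - \<gamma> n x)"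
        using K(2)[OF test_fun_diff[OF \<phi>(1)[of m] \<phi>(1)[of n]]]
        by (simp add: \<phi>(2) test_grad_diff[OF \<phi>(1) \<phi>(1)])
      also have "\<dots> \<le> (K + 1) * L2_norm \<Omega> (\<lambda>x. \<gamma> m x - \<gamma> n x)"
        by (intro mult_right_mono) (simp_all add: L2_norm_nonneg)
      also have "\<dots> < e" using N[OF mn] K(1) by (simp add: field_simps)
      finally show "L2_norm \<Omega> (\<lambda>x. \<phi> m x - \<phi> n x) < e" .
    qed
  qed (intro test_fun_L2 \<phi>)
  then obtain v where "L2_lim \<Omega> \<phi> v" by (rule L2_complete)
  with \<phi>(1) \<gamma>(2) have "H10_grad \<Omega> v g"
    unfolding H10_grad_def \<phi>(2) by (intro exI[of _ \<phi>]) simp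
  \<comment> \<open>The projection property is known for gradients of test functions and extends to
    their limits k by continuity of the inner product.\<close>
  moreover have "L2_inner \<Omega> g k = - L2_inner \<Omega> r (\<lambda>x. k x $ i)" if wk: "H10_grad \<Omega> w k" for w k
  proof -
    obtain \<psi> where \<psi>: "\<And>n. \<psi> n \<in> test_fun \<Omega>" "L2_lim \<Omega> (\<lambda>n. test_grad (\<psi> n)) k"
      using wk unfolding H10_grad_def by metis
    have "(\<lambda>n. L2_inner \<Omega> g (test_grad (\<psi> n))) \<longlonglongrightarrow> L2_inner \<Omega> g k"
      using \<gamma>(2) by (intro L2_lim_inner \<psi> L2_lim_const) (simp add: L2_lim_def)
    moreover have "(\<lambda>n. L2_inner \<Omega> F (test_grad (\<psi> n))) \<longlonglongrightarrow> L2_inner \<Omega> F k"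
      by (intro L2_lim_inner \<psi> L2_lim_const F)
    moreover have "L2_inner \<Omega> g (test_grad (\<psi> n)) = L2_inner \<Omega> F (test_grad (\<psi> n))" for n
      by (intro g imageI \<psi>)
    ultimately have "L2_inner \<Omega> g k = L2_inner \<Omega> F k"
      using LIMSEQ_unique[of "\<lambda>n. L2_inner \<Omega> g (test_grad (\<psi> n))"] by simp
    then show ?thesis unfolding F_inner .
  qed
  ultimately show thesis by (rule that)
qed

subsection \<open>The mixed system\<close>

lemma U_space_H10_grad:
  assumes "u \<in> U_space \<Omega>"
  shows "H10_grad \<Omega> (\<lambda>x. u x $ i) (\<lambda>x. grad \<Omega> u x $ i)"
  using H10_imp_H10_grad[of "\<lambda>x. u x $ i"] assms by (simp add: U_space_def grad_def)

lemma grad_L2: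
  assumes "u \<in> U_space \<Omega>"
  shows "(\<lambda>x. grad \<Omega> u x $ i) \<in> L2 \<Omega>" "(\<lambda>x. grad \<Omega> u x $ i $ j) \<in> L2 \<Omega>"
  using H10_grad_L2(2)[OF U_space_H10_grad[OF assms]] by (simp_all add: L2_vec_nth)

lemma divergence_eq: "divergence \<Omega> u = (\<lambda>x. grad \<Omega> u x $ 1 $ 1 + grad \<Omega> u x $ 2 $ 2)"
  by (rule ext) (simp add: divergence_def grad_def UNIV_2)

lemma divergence_L2: "u \<in> U_space \<Omega> \<Longrightarrow> divergence \<Omega> u \<in> L2 \<Omega>"
  unfolding divergence_eq by (intro L2_add grad_L2)

lemma divergence_Q0:
  assumes "u \<in> U_space \<Omega>"
  shows "divergence \<Omega> u \<in> Q0 \<Omega>"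
proof -
  have "L2_inner \<Omega> (divergence \<Omega> u) (\<lambda>x. 1) = 0"
    unfolding divergence_eq using H10_grad_mean[OF U_space_H10_grad[OF assms]]
    by (simp add: L2_inner_add_left grad_L2[OF assms] L2_const)
  then show ?thesis
    using divergence_L2[OF assms] by (simp add: Q0_def L2_inner_def)
qed

text \<open>Expanding the Frobenius product leaves half of the cross terms (d_2 u_1, d_1 z_2) + (d_1
  u_2, d_2 z_1). The interchange of derivatives turns them into (d_1 u_1, d_2 z_2) + (d_2 u_2, d_1
  z_1), the cross terms in the product of the divergences.\<close>

lemma sym_grad_inner:
  assumes u: "u \<in> U_space \<Omega>" and z: "z \<in> U_space \<Omega>"
  shows "L2_inner \<Omega> (sym_grad \<Omega> u) (sym_grad \<Omega> z)
    = (1/2) * (\<Sum>i\<in>UNIV. L2_inner \<Omega> (\<lambda>x. grad \<Omega> u x $ i) (\<lambda>x. grad \<Omega> z x $ i))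
    + (1/2) * L2_inner \<Omega> (divergence \<Omega> u) (divergence \<Omega> z)"
proof -
  define a where "a i j k l = L2_inner \<Omega> (\<lambda>x. grad \<Omega> u x $ i $ j) (\<lambda>x. grad \<Omega> z x $ k $ l)" for i j k l
  have int: "integrable (lebesgue_on \<Omega>) (\<lambda>x. grad \<Omega> u x $ i $ j * grad \<Omega> z x $ k $ l)" for i j k l
    using L2_integrable_inner[OF grad_L2(2)[OF u] grad_L2(2)[OF z], of i j k l] by simp
  have pw: "sym_grad \<Omega> u x \<bullet> sym_grad \<Omega> z x
      = grad \<Omega> u x $ 1 $ 1 * grad \<Omega> z x $ 1 $ 1 + grad \<Omega> u x $ 2 $ 2 * grad \<Omega> z x $ 2 $ 2
        + (1/2) * (grad \<Omega> u x $ 1 $ 2 * grad \<Omega> z x $ 1 $ 2 + grad \<Omega> u x $ 1 $ 2 * grad \<Omega> z x $ 2 $ 1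
          + grad \<Omega> u x $ 2 $ 1 * grad \<Omega> z x $ 1 $ 2 + grad \<Omega> u x $ 2 $ 1 * grad \<Omega> z x $ 2 $ 1)" for x
    by (simp add: sym_grad_def inner_vec_def UNIV_2 transpose_def field_simps)
  have "L2_inner \<Omega> (sym_grad \<Omega> u) (sym_grad \<Omega> z)
      = a 1 1 1 1 + a 2 2 2 2 + (1/2) * (a 1 2 1 2 + a 1 2 2 1 + a 2 1 1 2 + a 2 1 2 1)"
    unfolding L2_inner_def pw a_def by (simp add: int)
  moreover have "L2_inner \<Omega> (divergence \<Omega> u) (divergence \<Omega> z)
      = a 1 1 1 1 + a 1 1 2 2 + a 2 2 1 1 + a 2 2 2 2"
    unfolding divergence_eq a_def
    by (simp add: L2_inner_add_left L2_inner_add_right L2_add grad_L2[OF u] grad_L2[OF z])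
  moreover have "(\<Sum>i\<in>UNIV. L2_inner \<Omega> (\<lambda>x. grad \<Omega> u x $ i) (\<lambda>x. grad \<Omega> z x $ i))
      = a 1 1 1 1 + a 1 2 1 2 + a 2 1 2 1 + a 2 2 2 2"
    by (simp add: L2_inner_vec grad_L2[OF u] grad_L2[OF z] a_def UNIV_2)
  moreover have "a 1 1 2 2 = a 1 2 2 1" "a 2 2 1 1 = a 2 1 1 2"
    unfolding a_def by (rule H10_grad_swap[OF U_space_H10_grad[OF u] U_space_H10_grad[OF z]])+
  ultimately show ?thesis by (simp add: field_simps)
qed

text \<open>Eliminating \<open>p = (r - div u) / 2\<close> decouples the system into Dirichlet problems
  for the components of \<open>u\<close>.\<close>

lemma is_solution_iff:
  assumes r: "r \<in> Q0 \<Omega>"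
  shows "is_solution \<Omega> r p u \<longleftrightarrow> p \<in> Q0 \<Omega> \<and> u \<in> U_space \<Omega>
    \<and> ae_eq \<Omega> p (\<lambda>x. (1/2) * (r x - divergence \<Omega> u x))
    \<and> (\<forall>z\<in>U_space \<Omega>. (\<Sum>i\<in>UNIV. L2_inner \<Omega> (\<lambda>x. grad \<Omega> u x $ i) (\<lambda>x. grad \<Omega> z x $ i))
          = - L2_inner \<Omega> r (divergence \<Omega> z))"
proof (cases "p \<in> Q0 \<Omega> \<and> u \<in> U_space \<Omega>")
  case True
  then have p: "p \<in> Q0 \<Omega>" and u: "u \<in> U_space \<Omega>" by auto
  let ?d = "divergence \<Omega> u"
  define q where "q = (\<lambda>x. 2 * p x + ?d x)"
  have L: "p \<in> L2 \<Omega>" "r \<in> L2 \<Omega>" "?d \<in> L2 \<Omega>"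
    using p r divergence_L2[OF u] by (auto simp: Q0_def)
  have q_L2: "q \<in> L2 \<Omega>" unfolding q_def by (intro L2_add L2_cmult L)
  have int1: "integrable (lebesgue_on \<Omega>) f" if "f \<in> L2 \<Omega>" for f :: "real^2 \<Rightarrow> real"
    using L2_integrable_inner[OF that L2_const[of 1]] by simp
  \<comment> \<open>Testing the first equation with this residual makes its norm vanish, so the weak
    equation becomes an identity almost everywhere.\<close>
  have "(\<lambda>x. q x - r x) \<in> Q0 \<Omega>"
    using p r divergence_Q0[OF u] q_L2 L
    by (simp add: Q0_def L2_diff q_def int1)
  have first: "(\<forall>s\<in>Q0 \<Omega>. L2_inner \<Omega> q s = L2_inner \<Omega> r s) \<longleftrightarrow> ae_eq \<Omega> q r"
  proof
    assume *: "\<forall>s\<in>Q0 \<Omega>. L2_inner \<Omega> q s = L2_inner \<Omega> r s"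
    have "L2_norm \<Omega> (\<lambda>x. q x - r x) = 0"
      unfolding L2_norm_def
      using * \<open>(\<lambda>x. q x - r x) \<in> Q0 \<Omega>\<close> q_L2 L by (simp add: L2_inner_diff_left L2_diff)
    from L2_norm_eq_0D[OF L2_diff[OF q_L2 L(2)] this] show "ae_eq \<Omega> q r"
      by (simp add: ae_eq_def)
  next
    assume "ae_eq \<Omega> q r"
    then show "\<forall>s\<in>Q0 \<Omega>. L2_inner \<Omega> q s = L2_inner \<Omega> r s"
      using q_L2 L by (intro ballI L2_inner_cong) (auto simp: ae_eq_refl Q0_def)
  qed
  have "q x = r x \<longleftrightarrow> p x = (1/2) * (r x - ?d x)" for x
    by (auto simp: q_def field_simps)
  then have q_iff: "ae_eq \<Omega> q r \<longleftrightarrow> ae_eq \<Omega> p (\<lambda>x. (1/2) * (r x - ?d x))"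
    by (simp only: ae_eq_def)
  \<comment> \<open>The two forms of the second equation are equivalent once p is given by the
    formula: the products of the divergences then cancel exactly.\<close>
  have second: "L2_inner \<Omega> (sym_grad \<Omega> u) (sym_grad \<Omega> z) + L2_inner \<Omega> p (divergence \<Omega> z) = 0
      \<longleftrightarrow> (\<Sum>i\<in>UNIV. L2_inner \<Omega> (\<lambda>x. grad \<Omega> u x $ i) (\<lambda>x. grad \<Omega> z x $ i))
          = - L2_inner \<Omega> r (divergence \<Omega> z)"
    if ae: "ae_eq \<Omega> p (\<lambda>x. (1/2) * (r x - ?d x))" and z: "z \<in> U_space \<Omega>" for z
  proof -
    have "L2_inner \<Omega> p (divergence \<Omega> z) = L2_inner \<Omega> (\<lambda>x. (1/2) * (r x - ?d x)) (divergence \<Omega> z)"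
      by (intro L2_inner_cong ae ae_eq_refl L2_cmult L2_diff L divergence_L2[OF z])
    also have "\<dots> = (1/2) * (L2_inner \<Omega> r (divergence \<Omega> z) - L2_inner \<Omega> ?d (divergence \<Omega> z))"
      using L divergence_L2[OF z] by (simp only: L2_inner_cmult_left L2_inner_diff_left)
    finally show ?thesis
      unfolding sym_grad_inner[OF u z] by (auto simp: field_simps)
  qed
  have "is_solution \<Omega> r p u \<longleftrightarrow> (\<forall>s\<in>Q0 \<Omega>. L2_inner \<Omega> q s = L2_inner \<Omega> r s) \<and>
      (\<forall>z\<in>U_space \<Omega>. L2_inner \<Omega> (sym_grad \<Omega> u) (sym_grad \<Omega> z) + L2_inner \<Omega> p (divergence \<Omega> z) = 0)"
    using p u by (simp add: is_solution_def q_def)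
  also have "\<dots> \<longleftrightarrow> ae_eq \<Omega> p (\<lambda>x. (1/2) * (r x - ?d x)) \<and>
      (\<forall>z\<in>U_space \<Omega>. (\<Sum>i\<in>UNIV. L2_inner \<Omega> (\<lambda>x. grad \<Omega> u x $ i) (\<lambda>x. grad \<Omega> z x $ i))
          = - L2_inner \<Omega> r (divergence \<Omega> z))"
    unfolding first q_iff using second by blast
  finally show ?thesis using p u by blast
qed (auto simp: is_solution_def)

section \<open>Existence, uniqueness and the a priori bound\<close>

lemma solution_exists:
  assumes r: "r \<in> Q0 \<Omega>"
  shows "\<exists>p u. is_solution \<Omega> r p u"
proof -
  have r_L2: "r \<in> L2 \<Omega>" using r by (simp add: Q0_def)
  have "\<exists>v g. H10_grad \<Omega> v g \<and>
      (\<forall>w k. H10_grad \<Omega> w k \<longrightarrow> L2_inner \<Omega> g k = - L2_inner \<Omega> r (\<lambda>x. k x $ i))" for i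
    using Dirichlet_problem[OF r_L2, of i] by metis
  then obtain v g where vg: "\<And>i. H10_grad \<Omega> (v i) (g i)"
    "\<And>i w k. H10_grad \<Omega> w k \<Longrightarrow> L2_inner \<Omega> (g i) k = - L2_inner \<Omega> r (\<lambda>x. k x $ i)"
    by metis
  define u :: "real^2 \<Rightarrow> real^2" where "u = (\<lambda>x. \<chi> i. v i x)"
  define p where "p = (\<lambda>x. (1/2) * (r x - divergence \<Omega> u x))"
  have u: "u \<in> U_space \<Omega>"
    using H10_grad_imp_H10[OF vg(1)] by (simp add: U_space_def u_def)
  \<comment> \<open>\<open>grad\<close> is built from chosen weak derivatives, so it matches the
    gradients supplied by the Dirichlet problems only almost everywhere.\<close>
  have grad_u: "ae_eq \<Omega> (\<lambda>x. grad \<Omega> u x $ i) (g i)" for i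
    using H10_grad_unique[OF U_space_H10_grad[OF u] _, of i "g i"] vg(1)[of i] by (simp add: u_def)
  have int1: "integrable (lebesgue_on \<Omega>) f" if "f \<in> L2 \<Omega>" for f :: "real^2 \<Rightarrow> real"
    using L2_integrable_inner[OF that L2_const[of 1]] by simp
  have p: "p \<in> Q0 \<Omega>"
    using r divergence_Q0[OF u] L2_cmult[OF L2_diff[OF r_L2 divergence_L2[OF u]], of "1/2"]
    by (simp add: Q0_def p_def int1)
  have "(\<Sum>i\<in>UNIV. L2_inner \<Omega> (\<lambda>x. grad \<Omega> u x $ i) (\<lambda>x. grad \<Omega> z x $ i))
      = - L2_inner \<Omega> r (divergence \<Omega> z)" if z: "z \<in> U_space \<Omega>" for z
  proof -
    \<comment> \<open>The i-th Dirichlet problem tested with the i-th component of z; on summation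
      the right-hand sides assemble into the divergence of z.\<close>
    have "L2_inner \<Omega> (\<lambda>x. grad \<Omega> u x $ i) (\<lambda>x. grad \<Omega> z x $ i)
        = - L2_inner \<Omega> r (\<lambda>x. grad \<Omega> z x $ i $ i)" for i
    proof -
      have "L2_inner \<Omega> (\<lambda>x. grad \<Omega> u x $ i) (\<lambda>x. grad \<Omega> z x $ i)
          = L2_inner \<Omega> (g i) (\<lambda>x. grad \<Omega> z x $ i)"
        by (intro L2_inner_cong grad_u ae_eq_refl grad_L2[OF u] grad_L2[OF z] H10_grad_L2(2)[OF vg(1)])
      also have "\<dots> = - L2_inner \<Omega> r (\<lambda>x. grad \<Omega> z x $ i $ i)"
        by (rule vg(2)[OF U_space_H10_grad[OF z]])
      finally show ?thesis .
    qed
    then show ?thesis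
      by (simp add: UNIV_2 divergence_eq L2_inner_add_right r_L2 grad_L2[OF z])
  qed
  with p u show ?thesis
    unfolding is_solution_iff[OF r] by (intro exI[of _ p] exI[of _ u]) (simp add: p_def ae_eq_refl)
qed

text \<open>The difference of two velocities, used as test field in the difference of the decoupled
  equations, has gradient of norm zero because the data cancel. The Poincare inequality removes the
  velocity difference, and the formula for p removes the pressure difference.\<close>

lemma solution_unique:
  assumes r: "r \<in> Q0 \<Omega>" and sol: "is_solution \<Omega> r p u" and sol': "is_solution \<Omega> r p' u'"
  shows "ae_eq \<Omega> p' p \<and> ae_eq \<Omega> u' u"
proof -
  note S = sol[unfolded is_solution_iff[OF r]] and S' = sol'[unfolded is_solution_iff[OF r]]
  have u: "u \<in> U_space \<Omega>" and u': "u' \<in> U_space \<Omega>" using S S' by auto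
  define w where "w = (\<lambda>x. u' x - u x)"
  \<comment> \<open>The difference of the two chosen gradients; it agrees with the gradient chosen
    for w only almost everywhere.\<close>
  define D where "D i = (\<lambda>x. grad \<Omega> u' x $ i - grad \<Omega> u x $ i)" for i
  have D: "H10_grad \<Omega> (\<lambda>x. w x $ i) (D i)" for i
    using H10_grad_diff[OF U_space_H10_grad[OF u'] U_space_H10_grad[OF u], of i i]
    by (simp add: w_def D_def)
  have w: "w \<in> U_space \<Omega>"
    using H10_grad_imp_H10[OF D] by (simp add: U_space_def)
  have "(\<Sum>i\<in>UNIV. (L2_norm \<Omega> (D i))\<^sup>2) = (\<Sum>i\<in>UNIV. L2_inner \<Omega> (D i) (\<lambda>x. grad \<Omega> w x $ i))"
    unfolding L2_norm_power2
    by (intro sum.cong refl L2_inner_cong ae_eq_refl H10_grad_unique[OF D U_space_H10_grad[OF w]]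
        H10_grad_L2(2)[OF D] grad_L2[OF w])
  also have "\<dots> = (\<Sum>i\<in>UNIV. L2_inner \<Omega> (\<lambda>x. grad \<Omega> u' x $ i) (\<lambda>x. grad \<Omega> w x $ i))
      - (\<Sum>i\<in>UNIV. L2_inner \<Omega> (\<lambda>x. grad \<Omega> u x $ i) (\<lambda>x. grad \<Omega> w x $ i))"
    by (simp add: D_def L2_inner_diff_left grad_L2[OF u] grad_L2[OF u'] grad_L2[OF w] sum_subtractf)
  also have "\<dots> = 0" using S S' w by simp
  finally have D0: "L2_norm \<Omega> (D i) = 0" for i
    by (simp add: sum_nonneg_eq_0_iff)
  have D_ae: "ae_eq \<Omega> (D i) (\<lambda>x. 0)" for i
    by (rule L2_norm_eq_0D[OF H10_grad_L2(2)[OF D] D0])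
  obtain K where K: "\<And>v g. H10_grad \<Omega> v g \<Longrightarrow> L2_norm \<Omega> v \<le> K * L2_norm \<Omega> g"
    using Poincare by metis
  have "ae_eq \<Omega> (\<lambda>x. w x $ i) (\<lambda>x. 0)" for i
    using K[OF D[of i]] D0[of i] L2_norm_nonneg[of \<Omega> "\<lambda>x. w x $ i"]
    by (intro L2_norm_eq_0D H10_grad_L2(1)[OF D]) simp
  then have "ae_eq \<Omega> u' u"
    by (simp add: ae_eq_def w_def vec_eq_iff AE_all_countable)
  moreover have "ae_eq \<Omega> p' p"
  proof -
    have "ae_eq \<Omega> p (\<lambda>x. (1/2) * (r x - divergence \<Omega> u x))"
      "ae_eq \<Omega> p' (\<lambda>x. (1/2) * (r x - divergence \<Omega> u' x))"
      using S S' by auto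
    then show ?thesis
      using D_ae[of 1] D_ae[of 2] unfolding ae_eq_def D_def divergence_eq
      by eventually_elim simp
  qed
  ultimately show ?thesis by simp
qed

text \<open>An energy estimate: the decoupled equation with z = u bounds the squared gradient norm
  by the product of the norms of r and div u, and the latter is again controlled by the
  gradient.\<close>

lemma solution_bound:
  obtains C where "C > 0"
    "\<And>r p u. \<lbrakk>r \<in> Q0 \<Omega>; is_solution \<Omega> r p u\<rbrakk> \<Longrightarrow> L2_norm \<Omega> p + H1_norm_vec \<Omega> u \<le> C * L2_norm \<Omega> r"
proof -
  obtain K where K: "K \<ge> 0" "\<And>v g. H10_grad \<Omega> v g \<Longrightarrow> L2_norm \<Omega> v \<le> K * L2_norm \<Omega> g"
    using Poincare by metis
  define M where "M = sqrt (K\<^sup>2 + 1)"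
  \<comment> \<open>The gradient norm X is at most twice the norm of r. Hence p contributes at most
    (1 + 4) / 2 times that norm, rounded up to 3, and u contributes at most M X, thus 2 M times it;
    M adds the Poincare constant to the gradient part.\<close>
  have "L2_norm \<Omega> p + H1_norm_vec \<Omega> u \<le> (3 + 2 * M) * L2_norm \<Omega> r"
    if r: "r \<in> Q0 \<Omega>" and sol: "is_solution \<Omega> r p u" for r p u
  proof -
    note S = sol[unfolded is_solution_iff[OF r]]
    have u: "u \<in> U_space \<Omega>" and p: "p \<in> L2 \<Omega>" and r_L2: "r \<in> L2 \<Omega>"
      using S r by (auto simp: Q0_def)
    let ?d = "divergence \<Omega> u"
    define X where "X = sqrt (\<Sum>i\<in>UNIV. (L2_norm \<Omega> (\<lambda>x. grad \<Omega> u x $ i))\<^sup>2)"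
    have X2: "X\<^sup>2 = (\<Sum>i\<in>UNIV. (L2_norm \<Omega> (\<lambda>x. grad \<Omega> u x $ i))\<^sup>2)"
      unfolding X_def by (simp add: sum_nonneg)
    have X0: "X \<ge> 0" unfolding X_def by (simp add: sum_nonneg)
    have grad_le: "L2_norm \<Omega> (\<lambda>x. grad \<Omega> u x $ i $ j) \<le> X" for i j
    proof -
      have "L2_norm \<Omega> (\<lambda>x. grad \<Omega> u x $ i $ j) \<le> L2_norm \<Omega> (\<lambda>x. grad \<Omega> u x $ i)"
        by (rule L2_norm_vec_nth_le[OF grad_L2(1)[OF u]])
      also have "\<dots> \<le> X"
        unfolding X_def by (intro real_le_rsqrt member_le_sum) auto
      finally show ?thesis .
    qed
    have div_le: "L2_norm \<Omega> ?d \<le> 2 * X"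
      using L2_norm_triangle[OF grad_L2(2)[OF u] grad_L2(2)[OF u], of 1 1 2 2]
        grad_le[of 1 1] grad_le[of 2 2] by (simp add: divergence_eq)
    \<comment> \<open>The decoupled equation with the solution itself as test field.\<close>
    have "X\<^sup>2 = - L2_inner \<Omega> r ?d"
      using S u by (simp add: X2 L2_norm_power2)
    also have "\<dots> \<le> L2_norm \<Omega> r * L2_norm \<Omega> ?d"
      using L2_Cauchy_Schwarz[OF r_L2 divergence_L2[OF u]] by simp
    also have "\<dots> \<le> L2_norm \<Omega> r * (2 * X)"
      by (intro mult_left_mono div_le L2_norm_nonneg)
    finally have "X * X \<le> (2 * L2_norm \<Omega> r) * X" by (simp add: power2_eq_square mult_ac)
    then have X_le: "X \<le> 2 * L2_norm \<Omega> r"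
      using X0 L2_norm_nonneg[of \<Omega> r] by (cases "X = 0") (auto simp: mult_le_cancel_right)
    have "L2_norm \<Omega> p = (1/2) * L2_norm \<Omega> (\<lambda>x. r x - ?d x)"
      using L2_norm_cong[of \<Omega> p "\<lambda>x. (1/2) * (r x - ?d x)"] S p
        L2_cmult[OF L2_diff[OF r_L2 divergence_L2[OF u]], of "1/2"]
        L2_norm_cmult[of \<Omega> "1/2" "\<lambda>x. r x - ?d x"] by simp
    also have "\<dots> \<le> (1/2) * (L2_norm \<Omega> r + 2 * X)"
      using L2_norm_triangle_diff[OF r_L2 divergence_L2[OF u]] div_le by simp
    also have "\<dots> \<le> 3 * L2_norm \<Omega> r"
      using X_le L2_norm_nonneg[of \<Omega> r] by simp
    finally have p_le: "L2_norm \<Omega> p \<le> 3 * L2_norm \<Omega> r" .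
    have H1: "(H1_norm \<Omega> (\<lambda>x. u x $ i))\<^sup>2 \<le> (K\<^sup>2 + 1) * (L2_norm \<Omega> (\<lambda>x. grad \<Omega> u x $ i))\<^sup>2" for i
    proof -
      let ?g = "\<lambda>x. grad \<Omega> u x $ i"
      have "(H1_norm \<Omega> (\<lambda>x. u x $ i))\<^sup>2 = (L2_norm \<Omega> (\<lambda>x. u x $ i))\<^sup>2 + (L2_norm \<Omega> ?g)\<^sup>2"
        using L2_inner_vec[OF grad_L2(1)[OF u] grad_L2(1)[OF u], of i i]
        by (simp add: H1_norm_def sum_nonneg L2_norm_power2 grad_def L2_inner_self_nonneg)
      moreover have "(L2_norm \<Omega> (\<lambda>x. u x $ i))\<^sup>2 \<le> (K * L2_norm \<Omega> ?g)\<^sup>2"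
        by (intro power_mono K(2) U_space_H10_grad[OF u] L2_norm_nonneg)
      ultimately show ?thesis by (simp add: power_mult_distrib algebra_simps)
    qed
    have "(H1_norm_vec \<Omega> u)\<^sup>2 \<le> (M * X)\<^sup>2"
      using sum_mono[of UNIV, OF H1]
      by (simp add: H1_norm_vec_def sum_nonneg M_def power_mult_distrib X2 sum_distrib_left)
    then have "H1_norm_vec \<Omega> u \<le> M * X"
      by (rule power2_le_imp_le) (simp add: M_def X0)
    also have "\<dots> \<le> M * (2 * L2_norm \<Omega> r)"
      by (intro mult_left_mono X_le) (simp add: M_def)
    finally show ?thesis using p_le by (simp add: algebra_simps)
  qed
  moreover have "3 + 2 * M > 0" by (simp add: M_def add_pos_nonneg)
  ultimately show thesis using that by blast
qed

end

theorem proposition3p2: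
  fixes \<Omega> :: "(real^2) set"
  assumes "convex_polygonal_domain \<Omega>"
  shows "(\<forall>r\<in>Q0 \<Omega>. \<exists>p u. is_solution \<Omega> r p u \<and>
            (\<forall>p' u'. is_solution \<Omega> r p' u' \<longrightarrow> ae_eq \<Omega> p' p \<and> ae_eq \<Omega> u' u)) \<and>
         (\<exists>C>0. \<forall>r\<in>Q0 \<Omega>. \<forall>p u. is_solution \<Omega> r p u \<longrightarrow>
            L2_norm \<Omega> p + H1_norm_vec \<Omega> u \<le> C * L2_norm \<Omega> r)"
proof -
  interpret bounded_open_set \<Omega>
    by standard (use assms in \<open>auto simp: convex_polygonal_domain_def\<close>)
  obtain C where C: "C > 0"
    "\<And>r p u. \<lbrakk>r \<in> Q0 \<Omega>; is_solution \<Omega> r p u\<rbrakk> \<Longrightarrow> L2_norm \<Omega> p + H1_norm_vec \<Omega> u \<le> C * L2_norm \<Omega> r"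
    using solution_bound by blast
  show ?thesis
  proof (intro conjI ballI)
    fix r assume r: "r \<in> Q0 \<Omega>"
    then obtain p u where sol: "is_solution \<Omega> r p u"
      using solution_exists by blast
    then show "\<exists>p u. is_solution \<Omega> r p u \<and>
        (\<forall>p' u'. is_solution \<Omega> r p' u' \<longrightarrow> ae_eq \<Omega> p' p \<and> ae_eq \<Omega> u' u)"
      using solution_unique[OF r sol] by blast
  next
    show "\<exists>C>0. \<forall>r\<in>Q0 \<Omega>. \<forall>p u. is_solution \<Omega> r p u \<longrightarrow>
        L2_norm \<Omega> p + H1_norm_vec \<Omega> u \<le> C * L2_norm \<Omega> r"
      using C by blast
  qed
qed

end
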